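(* Let grid sizes $h_d>0$, $d\in\{x,y,z\}$, be given, and use the Gaussian window $\widehat W=\widehat W_{\mathrm{GS}}$ with shape parameter $\mathcal S>0$ and half-width support $H_d$ in dimension $d$, so that the number of grid points within the support of the window is $\mathcal P_d=2H_d/h_d+1$. If the bandwidth of the window is smaller than that of the mid-range Gaussians, i.e. $$H_d^2/\mathcal S<s_\ell^2\le s_m^2,\qquad \ell=0,1,\dots,m,\quad d\in\{x,y,z\},$$ then the error $\mathcal E^{\mathrm{scal}}_{\mathrm{mid}}$ caused by the gridding step (window truncation and discretization of the Fourier integral of the gridded charge) in the approximation of $\widehat S_{\mathrm{scal}}$ satisfies $$\left\|\mathcal E^{\mathrm{scal}}_{\mathrm{mid}}(\boldsymbol r_i)\right\|_\infty=O\left(\max_{d\in\{x,y,z\}}\left\{\sum_{\ell=0}^m w_\ell\,e^{-\frac{\pi^2\mu_d^\ell(\mathcal P_d-1)^2}{4s_\ell^2\mathcal S}}\right\}+\operatorname{erfc}\left(\sqrt{\mathcal S}\right)\right),$$ where $\mu_d^\ell=s_\ell^2-H_d^2/\mathcal S$ for $\ell=0,1,\dots,m$ and $d\in\{x,y,z\}$.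
   Context: System: charges $q_1,\dots,q_N\in\mathbb R$ with $\sum_i q_i=0$ at positions $\boldsymbol r_i\in[-L_x/2,L_x/2]\times[-L_y/2,L_y/2]\times[-L_z/2,L_z/2]$, periodic in $x,y$ and free in $z$. Write $\boldsymbol k=(\dot{\boldsymbol k},k_z)$, $k=|\boldsymbol k|$, $\boldsymbol r_{ij}=\boldsymbol r_i-\boldsymbol r_j$, $q_{\max}=\max_j|q_j|$, $\circ$ for the componentwise product, $\|\cdot\|_\infty$ for the maximum over $i$. Let $\mathcal K^2=\frac{2\pi}{L_x}\mathbb Z\times\frac{2\pi}{L_y}\mathbb Z$ and $\mathcal L[g(\boldsymbol k)]=\frac{1}{2\pi L_xL_y}\sum_{\dot{\boldsymbol k}\in\mathcal K^2}\int_{\mathbb R}g([\dot{\boldsymbol k},k_z])\,dk_z$. Sum-of-Gaussians (SOG) parameters: $b>1$, $\sigma>0$, $s_\ell=\sqrt2\,b^\ell\sigma$, $w_\ell=(\pi/2)^{-1/2}b^{-\ell}\sigma^{-1}\log b$ for $\ell\ge1$ and $w_0=\omega(\pi/2)^{-1/2}\sigma^{-1}\log b$ with fixed $\omega>0$. The mid-range Gaussians are those with $0\le\ell\le m$, where $s_m\le\eta L_z<s_{m+1}$ for a fixed $\eta>0$, and $\widehat\tau^{\mathrm{mid}}_{\mathrm{SOG}}(\boldsymbol k)=\frac{\sqrt\pi}{4}\sum_{\ell=0}^m w_\ell s_\ell^3k^2e^{-s_\ell^2k^2/4}$. Window: in each dimension $W_{\mathrm{GS}}(x)=e^{-\mathcal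 S(x/H)^2}$ for $|x|\le H$ and $0$ otherwise, and $\widehat W_{\mathrm{GS}}(k)=\sqrt{\pi/\mathcal S}\,H\,e^{-k^2H^2/(4\mathcal S)}$ (the Fourier transform of the untruncated Gaussian). The three-dimensional $W,\widehat W$ are the products over $d\in\{x,y,z\}$ with $H=H_d$. $\mathcal P_d$ is odd. Exact and computed scaled quantities: $$\widehat S_{\mathrm{scal}}(\boldsymbol k)=\frac{\widehat\tau^{\mathrm{mid}}_{\mathrm{SOG}}(\boldsymbol k)}{k^2|\widehat W(\boldsymbol k)|^2}\sum_{j=1}^Nq_j\widehat W(\boldsymbol k)e^{-\mathrm i\boldsymbol k\cdot\boldsymbol r_j},$$ $$\widehat S^{\boldsymbol{\mathcal P}}_{\mathrm{scal}}(\boldsymbol k)=\frac{\widehat\tau^{\mathrm{mid}}_{\mathrm{SOG}}(\boldsymbol k)}{k^2|\widehat W(\boldsymbol k)|^2}\sum_{j=1}^Nq_j\,V_h\sum_{\boldsymbol{\mathcal N}}W\left(\overline{\boldsymbol r}_j+\boldsymbol{\mathcal N}\circ\boldsymbol h-\boldsymbol r_j\right)e^{-\mathrm i\boldsymbol k\cdot(\overline{\boldsymbol r}_j+\boldsymbol{\mathcal N}\circ\boldsymbol h)},$$ where $\boldsymbol h=(h_x,h_y,h_z)$, $V_h=h_xh_yh_z$, $\overline{\boldsymbol r}_j$ is the point of the uniform grid of mesh $\boldsymbol h$ nearest to $\boldsymbol r_j$ (so $\overline{\boldsymbol r}_j=\boldsymbol r_j-\boldsymbol u_j\circ\boldsymbol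 h$ with $|u_{j,d}|\le1/2$), and $\boldsymbol{\mathcal N}$ ranges over integer vectors with $|\mathcal N_d|\le(\mathcal P_d-1)/2$. The error is $$\mathcal E^{\mathrm{scal}}_{\mathrm{mid}}(\boldsymbol r_i)=4\pi\,\mathcal L\left[\left(\widehat S_{\mathrm{scal}}(\boldsymbol k)-\widehat S^{\boldsymbol{\mathcal P}}_{\mathrm{scal}}(\boldsymbol k)\right)\widehat W(\boldsymbol k)e^{\mathrm i\boldsymbol k\cdot\boldsymbol r_i}\right].$$ Debye--H\"uckel (DH) assumption: there is a constant $C$ such that the charge sums entering the error, of the form $\sum_jq_je^{\mathrm i\boldsymbol k\cdot\boldsymbol r_{ij}}g_j$ with $|g_j|\le1$, are bounded in absolute value by $Cq_{\max}$ for all $i$ and $\boldsymbol k$. Standing approximation: in error estimates $\mathcal L[f]$ is replaced by $(2\pi)^{-3}\int_{\mathbb R^3}f(\boldsymbol k)\,d\boldsymbol k$. The $O(\cdot)$ refers to the regime where $\mathcal S$ and the exponents $\pi^2\mu_d^\ell(\mathcal P_d-1)^2/(4s_\ell^2\mathcal S)$ are bounded below by a positive constant (large in practice), with implied constant depending on $C$, $q_{\max}$, the $w_\ell,s_\ell$ and positive lower bounds for the $\mu_d^\ell$. $\operatorname{erfc}$ is the complementary error function. *)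

theory Defs
  imports "HOL-Analysis.Analysis"
begin

text \<open>
  Points of real and of reciprocal space are vectors of type \<^typ>\<open>real ^ 3\<close>; the coordinates
  $x$, $y$, $z$ are the components \<open>1\<close>, \<open>2\<close>, \<open>3\<close>.  Particles are numbered \<open>0, \<dots>, N - 1\<close>.
\<close>

definition erfc :: "real \<Rightarrow> real" where
  "erfc x = 2 / sqrt pi * (LBINT t:{x..}. exp (- t\<^sup>2))"


subsection \<open>Charges\<close>

definition charge_system ::
    "nat \<Rightarrow> (nat \<Rightarrow> real) \<Rightarrow> (nat \<Rightarrow> real ^ 3) \<Rightarrow> real ^ 3 \<Rightarrow> bool" where
  "charge_system N q r L \<longleftrightarrow>
     N \<ge> 1 \<and> (\<forall>d. L $ d > 0) \<and> (\<Sum>j<N. q j) = 0 \<and>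
     (\<forall>j<N. \<forall>d. - (L $ d) / 2 \<le> r j $ d \<and> r j $ d \<le> L $ d / 2)"

definition q_max :: "nat \<Rightarrow> (nat \<Rightarrow> real) \<Rightarrow> real" where
  "q_max N q = (MAX j\<in>{..<N}. \<bar>q j\<bar>)"


subsection \<open>Reciprocal space averages\<close>

definition lattice_avg :: "real ^ 3 \<Rightarrow> (real ^ 3 \<Rightarrow> complex) \<Rightarrow> complex" where
  "lattice_avg L g =
     of_real (1 / (2 * pi * L $ 1 * L $ 2)) *
     (\<Sum>\<^sub>\<infinity>(a, b)\<in>(UNIV :: (int \<times> int) set).
        LINT kz|lborel. g (vector [2 * pi / L $ 1 * of_int a, 2 * pi / L $ 2 * of_int b, kz]))"

text \<open>
  Error estimates are made under the standing approximation that the lattice average above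
  (the operator $\mathcal L$) is replaced by the following integral.
\<close>

definition bulk_avg :: "(real ^ 3 \<Rightarrow> complex) \<Rightarrow> complex" where
  "bulk_avg g = of_real (1 / (2 * pi) ^ 3) * (LINT k|lborel. g k)"


subsection \<open>Sum of Gaussians\<close>

definition sog_s :: "real \<Rightarrow> real \<Rightarrow> nat \<Rightarrow> real" where
  "sog_s b \<sigma> l = sqrt 2 * b ^ l * \<sigma>"

definition sog_w :: "real \<Rightarrow> real \<Rightarrow> real \<Rightarrow> nat \<Rightarrow> real" where
  "sog_w b \<sigma> \<omega> l =
     (if l = 0 then \<omega> * (pi / 2) powr (- 1 / 2) * inverse \<sigma> * ln b
      else (pi / 2) powr (- 1 / 2) * inverse (b ^ l) * inverse \<sigma> * ln b)"

definition tau_mid :: "real \<Rightarrow> real \<Rightarrow> real \<Rightarrow> nat \<Rightarrow> real ^ 3 \<Rightarrow> real" where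
  "tau_mid b \<sigma> \<omega> m k =
     sqrt pi / 4 * (\<Sum>l\<le>m. sog_w b \<sigma> \<omega> l * (sog_s b \<sigma> l) ^ 3 * (norm k)\<^sup>2 *
                              exp (- ((sog_s b \<sigma> l)\<^sup>2 * (norm k)\<^sup>2 / 4)))"


subsection \<open>Gaussian window\<close>

definition window1 :: "real \<Rightarrow> real \<Rightarrow> real \<Rightarrow> real" where
  "window1 S H x = (if \<bar>x\<bar> \<le> H then exp (- (S * (x / H)\<^sup>2)) else 0)"

text \<open>
  The Fourier transform of the Gaussian without truncation, hence not the transform of
  \<^const>\<open>window1\<close>.
\<close>

definition window1_hat :: "real \<Rightarrow> real \<Rightarrow> real \<Rightarrow> real" where
  "window1_hat S H k = sqrt (pi / S) * H * exp (- (k\<^sup>2 * H\<^sup>2 / (4 * S)))"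

definition window :: "real \<Rightarrow> real ^ 3 \<Rightarrow> real ^ 3 \<Rightarrow> real" where
  "window S H x = (\<Prod>d\<in>UNIV. window1 S (H $ d) (x $ d))"

definition window_hat :: "real \<Rightarrow> real ^ 3 \<Rightarrow> real ^ 3 \<Rightarrow> real" where
  "window_hat S H k = (\<Prod>d\<in>UNIV. window1_hat S (H $ d) (k $ d))"

definition mu :: "real \<Rightarrow> real \<Rightarrow> real \<Rightarrow> real ^ 3 \<Rightarrow> nat \<Rightarrow> 3 \<Rightarrow> real" where
  "mu b \<sigma> S H l d = (sog_s b \<sigma> l)\<^sup>2 - (H $ d)\<^sup>2 / S"


subsection \<open>Gridding\<close>

definition mesh_shift :: "real ^ 3 \<Rightarrow> int ^ 3 \<Rightarrow> real ^ 3" where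
  "mesh_shift h n = (\<chi> d. of_int (n $ d) * h $ d)"

definition uniform_grid :: "real ^ 3 \<Rightarrow> real ^ 3 \<Rightarrow> (real ^ 3) set" where
  "uniform_grid x0 h = range (\<lambda>n. x0 + mesh_shift h n)"

text \<open>At ties any of the nearest points may be chosen.\<close>

definition nearest_in :: "(real ^ 3) set \<Rightarrow> real ^ 3 \<Rightarrow> real ^ 3 \<Rightarrow> bool" where
  "nearest_in G x y \<longleftrightarrow> y \<in> G \<and> (\<forall>g\<in>G. dist x y \<le> dist x g)"

definition stencil :: "nat ^ 3 \<Rightarrow> (int ^ 3) set" where
  "stencil P = {n. \<forall>d. real_of_int \<bar>n $ d\<bar> \<le> (real (P $ d) - 1) / 2}"

definition cell_volume :: "real ^ 3 \<Rightarrow> real" where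
  "cell_volume h = (\<Prod>d\<in>UNIV. h $ d)"

text \<open>
  The quotient $\tau(k) / (k^2 |\widehat W(k)|^2)$ takes the value \<open>0\<close> at \<open>k = 0\<close> instead of its
  limit there; this concerns a single point of an integral.
\<close>

definition S_scal ::
    "(real ^ 3 \<Rightarrow> real) \<Rightarrow> real \<Rightarrow> real ^ 3 \<Rightarrow>
     nat \<Rightarrow> (nat \<Rightarrow> real) \<Rightarrow> (nat \<Rightarrow> real ^ 3) \<Rightarrow> real ^ 3 \<Rightarrow> complex" where
  "S_scal \<tau> S H N q r k =
     of_real (\<tau> k / ((norm k)\<^sup>2 * \<bar>window_hat S H k\<bar>\<^sup>2)) *
     (\<Sum>j<N. of_real (q j * window_hat S H k) * exp (- \<i> * of_real (k \<bullet> r j)))"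

definition S_scal_grid ::
    "(real ^ 3 \<Rightarrow> real) \<Rightarrow> real \<Rightarrow> real ^ 3 \<Rightarrow> real ^ 3 \<Rightarrow> nat ^ 3 \<Rightarrow>
     nat \<Rightarrow> (nat \<Rightarrow> real) \<Rightarrow> (nat \<Rightarrow> real ^ 3) \<Rightarrow> (nat \<Rightarrow> real ^ 3) \<Rightarrow> real ^ 3 \<Rightarrow> complex" where
  "S_scal_grid \<tau> S H h P N q r rbar k =
     of_real (\<tau> k / ((norm k)\<^sup>2 * \<bar>window_hat S H k\<bar>\<^sup>2)) *
     (\<Sum>j<N. of_real (q j) * (of_real (cell_volume h) *
        (\<Sum>n\<in>stencil P. of_real (window S H (rbar j + mesh_shift h n - r j)) *
                         exp (- \<i> * of_real (k \<bullet> (rbar j + mesh_shift h n))))))"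

text \<open>The first argument \<open>A\<close> is the average over reciprocal space.\<close>

definition error_scal ::
    "((real ^ 3 \<Rightarrow> complex) \<Rightarrow> complex) \<Rightarrow> (real ^ 3 \<Rightarrow> real) \<Rightarrow>
     real \<Rightarrow> real ^ 3 \<Rightarrow> real ^ 3 \<Rightarrow> nat ^ 3 \<Rightarrow>
     nat \<Rightarrow> (nat \<Rightarrow> real) \<Rightarrow> (nat \<Rightarrow> real ^ 3) \<Rightarrow> (nat \<Rightarrow> real ^ 3) \<Rightarrow> nat \<Rightarrow> complex" where
  "error_scal A \<tau> S H h P N q r rbar i =
     of_real (4 * pi) * A (\<lambda>k. (S_scal \<tau> S H N q r k - S_scal_grid \<tau> S H h P N q r rbar k) *
                     of_real (window_hat S H k) * exp (\<i> * of_real (k \<bullet> r i)))"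


subsection \<open>Debye-Hueckel assumption\<close>

text \<open>
  After collecting phases, the integrand of \<^const>\<open>error_scal\<close> is
  $\tau(k) / (k^2 \widehat W(k)) \sum_j q_j e^{\mathrm i k \cdot r_{ij}} B_j(k)$, where $B_j$ is the
  following gridding defect of particle $j$ in coordinates relative to that particle.
\<close>

definition grid_defect ::
    "real \<Rightarrow> real ^ 3 \<Rightarrow> real ^ 3 \<Rightarrow> nat ^ 3 \<Rightarrow>
     (nat \<Rightarrow> real ^ 3) \<Rightarrow> (nat \<Rightarrow> real ^ 3) \<Rightarrow> nat \<Rightarrow> real ^ 3 \<Rightarrow> complex" where
  "grid_defect S H h P r rbar j k =
     of_real (window_hat S H k) - of_real (cell_volume h) *
       (\<Sum>n\<in>stencil P. of_real (window S H (rbar j + mesh_shift h n - r j)) *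
                        exp (- \<i> * of_real (k \<bullet> (rbar j + mesh_shift h n - r j))))"

text \<open>
  The charge sums that enter the error are those with weights $g_j = B_j(k) / M$, where $M > 0$
  is any normalization for which $|g_j| \le 1$.  Demanding the bound for all weights with
  $|g_j| \le 1$ would be stronger: it would amount to $\sum_j |q_j| \le C q_{\max}$.
\<close>

definition debye_hueckel ::
    "real \<Rightarrow> real \<Rightarrow> real ^ 3 \<Rightarrow> real ^ 3 \<Rightarrow> nat ^ 3 \<Rightarrow>
     nat \<Rightarrow> (nat \<Rightarrow> real) \<Rightarrow> (nat \<Rightarrow> real ^ 3) \<Rightarrow> (nat \<Rightarrow> real ^ 3) \<Rightarrow> bool" where
  "debye_hueckel C S H h P N q r rbar \<longleftrightarrow>
     (\<forall>i<N. \<forall>k. \<forall>g :: nat \<Rightarrow> complex.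
        (\<exists>M>0. \<forall>j<N. g j = grid_defect S H h P r rbar j k / of_real M) \<longrightarrow>
        (\<forall>j<N. norm (g j) \<le> 1) \<longrightarrow>
        norm (\<Sum>j<N. of_real (q j) * exp (\<i> * of_real (k \<bullet> (r i - r j))) * g j) \<le> C * q_max N q)"

end

(* Pointwise in k the gridding defect of one particle is a difference of two products over the
   dimensions. In one dimension, Poisson summation for the modulated Gaussian writes the defect as
   aliases of the Gaussian window shifted by 2 pi j / h (j nonzero), plus the grid points cut off by the
   truncation. Against the mid-range Gaussian exp(- s^2 k^2 / 4), completing the square turns the
   j-th alias into a constant times exp(- E j^2), where E is the exponent of the theorem; the truncation
   contributes a constant times (sqrt S / p + 1 / sqrt S) exp(- S) with p = (P - 1) / 2.
   The Debye-Hueckel bound, normalized by a majorant of the defect that is a sum of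
   products over the dimensions, lets the integral over R^3 factor into these one-dimensional ones. *)

theory Submission
  imports Defs "HOL-Probability.Characteristic_Functions"
begin

section \<open>Poisson summation\<close>

text \<open>The truncation error shapes the estimates. After division by the window transform and
  integration it carries \<open>sqrt S / p * exp (- S)\<close>, whereas \<open>erfc (sqrt S)\<close>
  is only of order \<open>exp (- S) / sqrt S\<close>. If S is large compared with p, erfc cannot
  absorb it; the aliasing term does, since E is at most pi^2 p^2 / S. Dividing by the window
  transform multiplies by exp (H^2 k^2 / (4 S)). The mid-range Gaussian beats this growth because
  \<mu> > 0, and the lower bound \<mu>0 makes the resulting Gaussian masses uniform in grid and
  window. The Debye-Hueckel bound allows one normalization M for all particles at a given k. Hence
  the majorant must not see the offset of a particle from its grid point: the aliases are taken
  without their phases, and the tail is bounded for every offset of at most half a mesh width.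
  Poisson summation is stated for symmetric partial sums, so that inequalities between finite sums
  pass to the limit.\<close>

lemma integral_cos_power_cis_eq_0:
  fixes D :: "real \<Rightarrow> complex"
  assumes cont: "continuous_on {-1/2..1/2} D"
    and coeff: "\<And>m::int. integral {-1/2..1/2} (\<lambda>x. D x * cis (2 * pi * of_int m * x)) = 0"
  shows "integral {-1/2..1/2} (\<lambda>x. D x * cis (2 * pi * of_int m * x) * of_real ((cos (pi * x))\<^sup>2 ^ n)) = 0"
proof (induction n arbitrary: m)
  case 0
  then show ?case using coeff by simp
next
  case (Suc n)
  define F where "F m x = D x * cis (2 * pi * of_int m * x) * of_real ((cos (pi * x))\<^sup>2 ^ n)" for m :: int and x
  have F_int: "F m integrable_on {-1/2..1/2}" for m
    unfolding F_def by (intro integrable_continuous_interval continuous_intros cont)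
  \<comment> \<open>In exponential form, one factor cos^2 (pi x) moves the frequency by -1, 0 or 1.
    This is why the induction must run over all m at once.\<close>
  have "of_real ((cos (pi * x))\<^sup>2) = (2 + cis (2 * pi * x) + cis (- (2 * pi * x))) / (4::complex)" for x :: real
    using cos_double_cos[of "pi * x"] by (simp add: complex_eq_iff mult.assoc)
  moreover have "cis (2 * pi * of_int (m + 1) * x) = cis (2 * pi * of_int m * x) * cis (2 * pi * x)"
      "cis (2 * pi * of_int (m - 1) * x) = cis (2 * pi * of_int m * x) * cis (- (2 * pi * x))" for x
    by (simp_all add: cis_mult algebra_simps)
  ultimately have eq: "D x * cis (2 * pi * of_int m * x) * of_real ((cos (pi * x))\<^sup>2 ^ Suc n) =
      (1/2) * F m x + (1/4) * F (m + 1) x + (1/4) * F (m - 1) x" for x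
    unfolding F_def of_real_mult power_Suc by (simp only:) (simp add: algebra_simps add_divide_distrib)
  have "((\<lambda>x. (1/2) * F m x + (1/4) * F (m + 1) x + (1/4) * F (m - 1) x) has_integral
      (1/2) * 0 + (1/4) * 0 + (1/4) * 0) {-1/2..1/2}"
    using Suc.IH F_int unfolding F_def[symmetric]
    by (intro has_integral_add has_integral_mult_right) (metis has_integral_integrable_integral)+
  then show ?case
    unfolding eq by (simp add: has_integral_iff)
qed


text \<open>The nonnegative trigonometric polynomials \<open>(cos\<^sup>2 (\<pi> x) / cos\<^sup>2 (\<pi> d))\<^sup>n\<close> blow up near \<open>0\<close> and are at most
  \<open>1\<close> for \<open>d \<le> \<bar>x\<bar> \<le> 1/2\<close>, so integrating \<open>D\<close> against them detects \<open>D 0\<close>.\<close>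

lemma eq_0_if_fourier_coefficients_eq_0:
  fixes D :: "real \<Rightarrow> complex"
  assumes cont: "continuous_on {-1/2..1/2} D"
    and coeff: "\<And>m::int. integral {-1/2..1/2} (\<lambda>x. D x * cis (2 * pi * of_int m * x)) = 0"
  shows "D 0 = 0"
proof (rule ccontr)
  assume nz: "D 0 \<noteq> 0"
  \<comment> \<open>Multiplying by \<open>cnj (D 0)\<close> rotates the value at 0 to the positive
    number |D 0|^2, so the contradiction can be reached with real inequalities.\<close>
  define \<phi> where "\<phi> x = Re (cnj (D 0) * D x)" for x
  have \<phi>_cont: "continuous_on {-1/2..1/2} \<phi>"
    unfolding \<phi>_def by (intro continuous_intros cont)
  have \<phi>0: "\<phi> 0 > 0"
  proof -
    have "\<phi> 0 = (cmod (D 0))\<^sup>2"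
      unfolding cmod_power2 by (simp add: \<phi>_def power2_eq_square)
    then show ?thesis using nz by simp
  qed
  obtain B where B: "\<And>x. x \<in> {-1/2..1/2} \<Longrightarrow> \<bar>\<phi> x\<bar> \<le> B"
    using compact_imp_bounded[OF compact_continuous_image[OF \<phi>_cont]]
    unfolding bounded_iff by (metis compact_Icc imageI real_norm_def)
  have "B \<ge> 0" using B[of 0] by simp
  obtain e where e: "e > 0" "\<And>x. x \<in> {-1/2..1/2} \<Longrightarrow> \<bar>x\<bar> < e \<Longrightarrow> \<bar>\<phi> x - \<phi> 0\<bar> < \<phi> 0 / 2"
    using \<phi>_cont[unfolded continuous_on_iff, rule_format, of 0 "\<phi> 0 / 2"] \<phi>0
    by (auto simp: dist_real_def)
  define d where "d = min (1/4) (e / 2)"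
  have d: "0 < d" "d \<le> 1/4" "d < e" using e(1) by (auto simp: d_def)
  have pos: "\<phi> x \<ge> \<phi> 0 / 2" if "\<bar>x\<bar> \<le> d" for x
    using e(2)[of x] that d by (auto simp: abs_if split: if_splits)
  have cd: "cos (pi * d) > 0"
    using d by (intro cos_gt_zero) auto
  define p where "p x = (cos (pi * x) / cos (pi * d))\<^sup>2" for x
  have cos_mono: "cos (pi * y) \<le> cos (pi * x)" if "\<bar>x\<bar> \<le> \<bar>y\<bar>" "\<bar>y\<bar> \<le> 1/2" for x y
  proof -
    have "cos (pi * \<bar>y\<bar>) \<le> cos (pi * \<bar>x\<bar>)"
      using that by (intro cos_monotone_0_pi_le) auto
    then show ?thesis by (simp add: abs_if split: if_splits)
  qed
  have cnn: "cos (pi * x) \<ge> 0" if "\<bar>x\<bar> \<le> 1/2" for x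
    using cos_mono[of x "1/2"] that by simp
  have p_out: "p x \<le> 1" if "d \<le> \<bar>x\<bar>" "\<bar>x\<bar> \<le> 1/2" for x
    using cos_mono[of d x] cnn[of x] that d cd by (auto simp: p_def abs_le_square_iff power_divide)
  \<comment> \<open>The cosine is strictly larger at d / 2 than at d, so on |x| <= d / 2 the powers
    of \<open>p\<close> grow at least like q^n with q > 1.\<close>
  define q where "q = p (d / 2)"
  have "cos (pi * d) < cos (pi * (d / 2))"
    using d by (intro cos_monotone_0_pi) auto
  then have q: "q > 1"
    using cd by (simp add: q_def p_def one_less_power)
  have p_in: "p x \<ge> q" if "\<bar>x\<bar> \<le> d / 2" for x
    unfolding q_def p_def using cos_mono[of x "d / 2"] that d cd cnn[of "d/2"]
    by (intro power_mono divide_right_mono) auto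
  have p_nn: "p x \<ge> 0" for x by (simp add: p_def)
  \<comment> \<open>With this n the central interval, of length d, contributes more than B + 1,
    while the two outer intervals have total length 1 - d and lose at most B (1 - d).\<close>
  obtain n where n: "2 * (B + 1) / (d * \<phi> 0) < q ^ n"
    using real_arch_pow[OF q] by blast
  define \<psi> where "\<psi> x = \<phi> x * p x ^ n" for x
  have \<psi>_cont: "continuous_on {-1/2..1/2} \<psi>"
    unfolding \<psi>_def p_def using cd by (intro continuous_intros \<phi>_cont) auto
  have \<psi>_int: "\<psi> integrable_on {a..b}" if "{a..b} \<subseteq> {-1/2..1/2}" for a b
    by (rule integrable_continuous_interval) (rule continuous_on_subset[OF \<psi>_cont that])
  \<comment> \<open>For d / 2 < |x| <= d the factor \<open>p x\<close> may exceed 1, but there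
    \<phi> is positive; beyond d it is at most 1. Either way the lower bound is independent of
    n.\<close>
  have \<psi>_B: "- B \<le> \<psi> x" if "x \<in> {-1/2..1/2}" for x
  proof (cases "\<bar>x\<bar> \<le> d")
    case True
    then have "0 \<le> \<psi> x"
      unfolding \<psi>_def using pos[OF True] \<phi>0 p_nn[of x] by (intro mult_nonneg_nonneg zero_le_power) auto
    then show ?thesis using \<open>B \<ge> 0\<close> by simp
  next
    case False
    then have "p x ^ n \<le> 1" using p_out[of x] p_nn[of x] that by (intro power_le_one) auto
    then have "\<bar>\<psi> x\<bar> \<le> B * 1"
      unfolding \<psi>_def abs_mult using B[OF that] p_nn[of x] \<open>B \<ge> 0\<close> by (intro mult_mono) auto
    then show ?thesis by simp
  qed
  have "(\<lambda>x. D x * of_real ((cos (pi * x))\<^sup>2 ^ n)) integrable_on {-1/2..1/2}"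
    by (intro integrable_continuous_interval continuous_intros cont)
  then have "((\<lambda>x. D x * of_real ((cos (pi * x))\<^sup>2 ^ n)) has_integral 0) {-1/2..1/2}"
    using integral_cos_power_cis_eq_0[OF cont coeff, of 0 n] by (simp add: has_integral_iff)
  from has_integral_Re[OF has_integral_mult_right[OF this, of "cnj (D 0) * of_real ((1 / (cos (pi * d))\<^sup>2) ^ n)"]]
  have "((\<lambda>x. \<psi> x) has_integral 0) {-1/2..1/2}"
    by (simp add: \<psi>_def \<phi>_def p_def power_divide algebra_simps flip: of_real_power)
  then have "integral {-1/2..1/2} \<psi> = 0" by (simp add: integral_unique)
  then have "0 = integral {-1/2..-d/2} \<psi> + (integral {-d/2..d/2} \<psi> + integral {d/2..1/2} \<psi>)"
    using d \<psi>_int by (simp add: Henstock_Kurzweil_Integration.integral_combine)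
  moreover have "integral {-1/2..-d/2} \<psi> \<ge> integral {-1/2..-d/2} (\<lambda>_. - B)"
    using d by (intro integral_le \<psi>_int \<psi>_B) auto
  moreover have "integral {d/2..1/2} \<psi> \<ge> integral {d/2..1/2} (\<lambda>_. - B)"
    using d by (intro integral_le \<psi>_int \<psi>_B) auto
  moreover have "integral {-d/2..d/2} \<psi> \<ge> integral {-d/2..d/2} (\<lambda>_. \<phi> 0 / 2 * q ^ n)"
  proof (intro integral_le \<psi>_int)
    fix x assume x: "x \<in> {-d/2..d/2}"
    then have "\<bar>x\<bar> \<le> d / 2" "\<bar>x\<bar> \<le> d" using d by auto
    then have "\<phi> 0 / 2 \<le> \<phi> x" "q \<le> p x" by (simp_all only: pos p_in)
    then show "\<phi> 0 / 2 * q ^ n \<le> \<psi> x"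
      unfolding \<psi>_def using \<phi>0 q by (intro mult_mono power_mono) auto
  qed (use d in auto)
  ultimately have "d * (\<phi> 0 / 2 * q ^ n) \<le> B * (1 - d)" using d
    by (simp add: algebra_simps)
  also have "\<dots> \<le> B + 1" using d \<open>B \<ge> 0\<close> by (simp add: algebra_simps)
  finally show False using n d \<phi>0 by (simp add: field_simps)
qed

lemma integral_cis_period:
  "integral {-1/2..1/2} (\<lambda>x. cis (2 * pi * of_int m * x)) = (if m = 0 then 1 else 0)"
proof (cases "m = 0")
  case False
  define a where "a = 2 * pi * of_int m"
  have "a \<noteq> 0" using False by (simp add: a_def)
  have "((\<lambda>x. cis (a * x)) has_integral cis (a * (1/2)) / (\<i> * a) - cis (a * (-1/2)) / (\<i> * a)) {-1/2..1/2}"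
  proof (rule fundamental_theorem_of_calculus)
    fix x :: real
    have "((\<lambda>z. exp (\<i> * (of_real a * z)) / (\<i> * of_real a)) has_field_derivative exp (\<i> * (of_real a * of_real x)))
        (at (of_real x))"
      using \<open>a \<noteq> 0\<close> by (auto intro!: derivative_eq_intros simp: field_simps)
    from has_vector_derivative_real_field[OF this]
    show "((\<lambda>x. cis (a * x) / (\<i> * a)) has_vector_derivative cis (a * x)) (at x within {-1/2..1/2})"
      unfolding cis_conv_exp of_real_mult .
  qed simp
  moreover have "cis (a * (1/2)) = cis (a * (-1/2))"
  proof -
    have "a * (1/2) = a * (-1/2) + 2 * pi * of_int m" by (simp add: a_def)
    then have "cis (a * (1/2)) = cis (a * (-1/2)) * cis (2 * pi * of_int m)" by (simp only: cis_mult)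
    also have "cis (2 * pi * of_int m) = 1" by (intro cis_multiple_2pi) simp
    finally show ?thesis by simp
  qed
  ultimately show ?thesis using False by (simp add: a_def integral_unique)
qed simp

text \<open>Pairing n with -n turns symmetric sums over the integers into series over the naturals,
  to which the Weierstrass test and geometric majorants apply.\<close>

lemma sum_int_symmetric:
  fixes f :: "int \<Rightarrow> 'a::comm_monoid_add"
  shows "(\<Sum>n\<in>{- int R..int R}. f n) = (\<Sum>j\<le>R. if j = 0 then f 0 else f (int j) + f (- int j))"
proof (induction R)
  case (Suc R)
  have "{- int (Suc R)..int (Suc R)} = insert (int (Suc R)) (insert (- int (Suc R)) {- int R..int R})"
    by auto
  then show ?case using Suc by (simp add: ac_simps)
qed simp

text \<open>The unit cells centred at the integers -R, ..., R tile the large interval. In this way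
  Fourier coefficients of the periodized function become Fourier integrals over the line.\<close>

lemma integral_translates:
  fixes g :: "real \<Rightarrow> complex"
  assumes "continuous_on UNIV g"
  shows "(\<Sum>n\<in>{- int R..int R}. integral {-1/2..1/2} (\<lambda>x. g (x + of_int n))) =
    integral {- real R - 1/2..real R + 1/2} g"
proof (induction R)
  case (Suc R)
  have int: "g integrable_on {a..b}" for a b
    by (rule integrable_continuous_interval) (rule continuous_on_subset[OF assms], simp)
  have shift: "integral {-1/2..1/2} (\<lambda>x. g (x + c)) = integral {c - 1/2..c + 1/2} g" for c
    using integral_shift_real_ivl[of "c - 1/2" c "c + 1/2" g] by simp
  have *: "{- int (Suc R)..int (Suc R)} = insert (int (Suc R)) (insert (- int (Suc R)) {- int R..int R})"
    by auto
  have "integral {- real (Suc R) - 1/2..real (Suc R) + 1/2} g =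
     integral {- real (Suc R) - 1/2..- real R - 1/2} g + integral {- real R - 1/2..real R + 1/2} g
       + integral {real R + 1/2..real (Suc R) + 1/2} g"
    by (subst Henstock_Kurzweil_Integration.integral_combine[symmetric, of _ "- real R - 1/2"],
        simp, simp, rule int,
        subst Henstock_Kurzweil_Integration.integral_combine[symmetric, of _ "real R + 1/2"],
        simp, simp, rule int, simp)
  also have "integral {- real (Suc R) - 1/2..- real R - 1/2} g = integral {-1/2..1/2} (\<lambda>x. g (x + of_int (- int (Suc R))))"
    unfolding shift by (rule arg_cong[where f = "\<lambda>S. integral S g"]) auto
  also have "integral {real R + 1/2..real (Suc R) + 1/2} g = integral {-1/2..1/2} (\<lambda>x. g (x + of_int (int (Suc R))))"
    unfolding shift by (rule arg_cong[where f = "\<lambda>S. integral S g"]) auto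
  finally show ?case
    unfolding * Suc.IH[symmetric] by simp
qed simp

text \<open>The differences of partial sums, with \<open>f\<close> translated by \<open>x\<close>, converge uniformly on \<open>[-1/2, 1/2]\<close> to a
  function \<open>L\<close> with vanishing Fourier coefficients, hence \<open>L 0 = 0\<close>.\<close>

theorem poisson_summation:
  fixes f :: "real \<Rightarrow> complex" and c :: "int \<Rightarrow> complex" and a :: "nat \<Rightarrow> real"
  assumes cont: "continuous_on UNIV f"
    and decay: "\<And>x j. \<bar>x\<bar> \<le> 1/2 \<Longrightarrow> norm (f (x + real j)) \<le> a j \<and> norm (f (x - real j)) \<le> a j"
    and coeff_decay: "\<And>j. norm (c (int j)) \<le> a j \<and> norm (c (- int j)) \<le> a j"
    and a: "summable a"
    and coeff: "\<And>m. (\<lambda>R. integral {- real R - 1/2..real R + 1/2} (\<lambda>x. f x * cis (- (2 * pi * of_int m * x)))) \<longlonglongrightarrow> c m"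
  shows "(\<lambda>R. (\<Sum>n\<in>{- int R..int R}. f (of_int n)) - (\<Sum>n\<in>{- int R..int R}. c n)) \<longlonglongrightarrow> 0"
proof -
  define e where "e m x = cis (2 * pi * of_int m * x)" for m :: int and x :: real
  define d where "d j x = (if j = 0 then f x - c 0 else
     f (x + real j) - c (int j) * e (int j) x + (f (x - real j) - c (- int j) * e (- int j) x))" for j x
  define D where "D R x = (\<Sum>j\<le>R. d j x)" for R x
  have D_eq: "D R x = (\<Sum>n\<in>{- int R..int R}. f (x + of_int n) - c n * e n x)" for R x
    unfolding D_def d_def sum_int_symmetric by (intro sum.cong) (auto simp: e_def)
  have e_cont: "continuous_on S (e m)" for S m
    unfolding e_def by (intro continuous_intros)
  have f_cont: "continuous_on S (\<lambda>x. f (x + t))" for S t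
    using continuous_on_compose2[OF cont, of S "\<lambda>x. x + t"] by (simp add: continuous_intros)
  have D_cont: "continuous_on {-1/2..1/2} (D R)" for R
    unfolding D_eq[abs_def] by (intro continuous_intros f_cont e_cont)
  have a_nn: "a j \<ge> 0" for j using decay[of 0 j] norm_ge_zero order_trans by (metis abs_zero zero_le_divide_1_iff zero_le_numeral)
  have "uniform_limit {-1/2..1/2} (\<lambda>R x. \<Sum>j<R. d j x) (\<lambda>x. \<Sum>j. d j x) sequentially"
  proof (rule Weierstrass_m_test)
    \<comment> \<open>The summand \<open>d j x\<close> with j > 0 has four terms, two translates and
      two modes, each bounded by \<open>a j\<close>.\<close>
    show "summable (\<lambda>j. 4 * a j)" using a by (rule summable_mult)
    show "norm (d j x) \<le> 4 * a j" if x: "x \<in> {-1/2..1/2}" for j x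
    proof -
      have "\<bar>x\<bar> \<le> 1/2" using x by auto
      note b = decay[OF this, of j] coeff_decay[of j]
      have n: "norm (c m * e m x) = norm (c m)" for m by (simp add: e_def norm_mult)
      show ?thesis
      proof (cases "j = 0")
        case True
        then show ?thesis using b a_nn[of 0] norm_triangle_ineq4[of "f x" "c 0"] by (simp add: d_def)
      next
        case False
        have "norm (d j x) \<le> norm (f (x + real j)) + norm (c (int j) * e (int j) x) +
            (norm (f (x - real j)) + norm (c (- int j) * e (- int j) x))"
          unfolding d_def using False by (auto intro!: norm_triangle_mono norm_triangle_ineq4)
        then show ?thesis using b unfolding n by simp
      qed
    qed
  qed
  then have lim: "uniform_limit {-1/2..1/2} D (\<lambda>x. \<Sum>j. d j x) sequentially"
    unfolding D_def[abs_def] lessThan_Suc_atMost[symmetric]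
    by (rule filterlim_compose[OF _ filterlim_Suc])
  define L where "L x = (\<Sum>j. d j x)" for x
  note lim = lim[folded L_def]
  have L_cont: "continuous_on {-1/2..1/2} L"
    by (rule uniform_limit_theorem[OF always_eventually lim]) (simp_all only: D_cont simp_thms trivial_limit_sequentially)
  have "integral {-1/2..1/2} (\<lambda>x. L x * e m x) = 0" for m
  proof -
    have "uniform_limit {-1/2..1/2} (\<lambda>R x. D R x * e m x) (\<lambda>x. L x * e m x) sequentially"
      by (rule uniform_lim_mult[OF lim uniform_limit_const])
        (intro compact_imp_bounded compact_continuous_image e_cont L_cont compact_Icc)+
    then obtain I J where I: "\<And>R. ((\<lambda>x. D R x * e m x) has_integral I R) {-1/2..1/2}"
        and J: "((\<lambda>x. L x * e m x) has_integral J) {-1/2..1/2}" and "I \<longlonglongrightarrow> J"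
      by (rule uniform_limit_integral[where F = sequentially]) (intro continuous_on_mult D_cont e_cont, simp, blast)
    \<comment> \<open>The character \<open>e m\<close> is 1-periodic, so it can be translated along
      with f and the cells merge into one interval. Orthogonality leaves, of the modes, only the one
      with n = -m, which is present as soon as R >= |m|.\<close>
    have "I R = integral {- real R - 1/2..real R + 1/2} (\<lambda>x. f x * e m x)
        - (\<Sum>n\<in>{- int R..int R}. c n * (if n + m = 0 then 1 else 0))" for R
    proof -
      have "I R = integral {-1/2..1/2} (\<lambda>x. \<Sum>n\<in>{- int R..int R}. f (x + of_int n) * e m x - c n * e (n + m) x)"
        using I[of R] unfolding D_eq sum_distrib_right left_diff_distrib
        by (simp add: e_def cis_mult algebra_simps integral_unique)
      also have "\<dots> = (\<Sum>n\<in>{- int R..int R}. integral {-1/2..1/2} (\<lambda>x. f (x + of_int n) * e m x)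
          - c n * integral {-1/2..1/2} (e (n + m)))"
        by (subst integral_sum, simp, intro integrable_continuous_interval continuous_intros f_cont e_cont,
            intro sum.cong refl, subst integral_diff) 
          (auto intro!: integrable_continuous_interval continuous_intros f_cont e_cont)
      also have "\<dots> = (\<Sum>n\<in>{- int R..int R}. integral {-1/2..1/2} (\<lambda>x. f (x + of_int n) * e m (x + of_int n)))
          - (\<Sum>n\<in>{- int R..int R}. c n * (if n + m = 0 then 1 else 0))"
      proof -
        have "e m (x + of_int n) = e m x" for x n
          unfolding e_def using cis_multiple_2pi[of "of_int (m * n)"]
          by (simp add: algebra_simps flip: cis_mult)
        then show ?thesis unfolding e_def integral_cis_period by (simp add: sum_subtractf)
      qed
      also have "(\<Sum>n\<in>{- int R..int R}. integral {-1/2..1/2} (\<lambda>x. f (x + of_int n) * e m (x + of_int n))) =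
          integral {- real R - 1/2..real R + 1/2} (\<lambda>x. f x * e m x)"
        by (rule integral_translates) (auto intro!: continuous_intros cont e_cont)
      finally show ?thesis .
    qed
    moreover have "(\<Sum>n\<in>{- int R..int R}. c n * (if n + m = 0 then 1 else 0)) = c (- m)" if "R \<ge> nat \<bar>m\<bar>" for R
    proof -
      have "(\<Sum>n\<in>{- int R..int R}. c n * (if n + m = 0 then 1 else 0)) = (\<Sum>n\<in>{- int R..int R}. if n = - m then c n else 0)"
        by (intro sum.cong) auto
      also have "\<dots> = c (- m)" using that by (subst sum.delta) auto
      finally show ?thesis .
    qed
    then have "(\<lambda>R. \<Sum>n\<in>{- int R..int R}. c n * (if n + m = 0 then 1 else 0)) \<longlonglongrightarrow> c (- m)"
      by (intro tendsto_eventually) (auto simp: eventually_sequentially)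
    moreover have "(\<lambda>R. integral {- real R - 1/2..real R + 1/2} (\<lambda>x. f x * e m x)) \<longlonglongrightarrow> c (- m)"
      using coeff[of "- m"] by (simp add: e_def)
    ultimately have "(\<lambda>R. I R) \<longlonglongrightarrow> c (- m) - c (- m)" by (simp only: tendsto_diff)
    then have "I \<longlonglongrightarrow> 0" by simp
    then show ?thesis using J \<open>I \<longlonglongrightarrow> J\<close> by (auto dest: LIMSEQ_unique)
  qed
  with L_cont have "L 0 = 0" unfolding e_def by (rule eq_0_if_fourier_coefficients_eq_0)
  moreover have "(\<lambda>R. D R 0) \<longlonglongrightarrow> L 0" by (rule tendsto_uniform_limitI[OF lim]) auto
  ultimately show ?thesis unfolding D_eq by (simp add: e_def sum_subtractf)
qed

section \<open>Gaussians\<close>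

lemma has_bochner_integral_gaussian:
  assumes "\<alpha> > 0"
  shows "has_bochner_integral lborel (\<lambda>x. exp (- (\<alpha> * (x - u)\<^sup>2))) (sqrt (pi / \<alpha>))"
proof -
  define s where "s = 1 / sqrt (2 * \<alpha>)"
  have s: "s > 0" "s\<^sup>2 = 1 / (2 * \<alpha>)" using assms by (auto simp: s_def power_divide)
  have "has_bochner_integral lborel (\<lambda>x. sqrt (pi / \<alpha>) * normal_density u s x) (sqrt (pi / \<alpha>) * 1)"
    using s(1) by (intro has_bochner_integral_mult_right)
      (simp add: has_bochner_integral_iff integrable_normal_density integral_normal_density)
  moreover have "sqrt (pi / \<alpha>) * normal_density u s x = exp (- (\<alpha> * (x - u)\<^sup>2))" for x
    using assms unfolding normal_density_def s(2)
    by (simp add: real_sqrt_divide real_sqrt_mult field_simps)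
  ultimately show ?thesis by simp
qed

lemma nn_integral_gaussian:
  assumes "\<alpha> > 0"
  shows "(\<integral>\<^sup>+x. ennreal (exp (- (\<alpha> * (x - u)\<^sup>2))) \<partial>lborel) = ennreal (sqrt (pi / \<alpha>))"
  using has_bochner_integral_gaussian[OF assms, of u]
  by (subst nn_integral_eq_integral) (auto simp: has_bochner_integral_iff)

text \<open>This is the characteristic function exp (- t^2 / 2) of the standard normal distribution
  after the substitution x -> c x with c^2 = 2 \<alpha>.\<close>

lemma integral_gaussian_cis:
  assumes "\<alpha> > 0"
  shows "(LINT x|lborel. of_real (exp (- (\<alpha> * x\<^sup>2))) * cis (t * x)) =
    complex_of_real (sqrt (pi / \<alpha>) * exp (- (t\<^sup>2 / (4 * \<alpha>))))"
proof -
  define c where "c = sqrt (2 * \<alpha>)"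
  have c: "c > 0" "c\<^sup>2 = 2 * \<alpha>" using assms by (auto simp: c_def)
  have "complex_of_real (exp (- ((t / c)\<^sup>2 / 2))) = char std_normal_distribution (t / c)"
    by (simp add: char_std_normal_distribution)
  also have "\<dots> = (LINT x|lborel. std_normal_density x *\<^sub>R iexp (t / c * x))"
    unfolding char_def by (subst integral_density) auto
  also have "\<dots> = \<bar>c\<bar> *\<^sub>R (LINT x|lborel. std_normal_density (0 + c * x) *\<^sub>R iexp (t / c * (0 + c * x)))"
    using c by (intro lborel_integral_real_affine) auto
  also have "(\<lambda>x. std_normal_density (0 + c * x) *\<^sub>R iexp (t / c * (0 + c * x))) =
      (\<lambda>x. of_real (1 / sqrt (2 * pi)) * (of_real (exp (- (\<alpha> * x\<^sup>2))) * cis (t * x)))"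
    using c by (auto simp: normal_density_def power_mult_distrib cis_conv_exp scaleR_conv_of_real fun_eq_iff)
  also have "(LINT x|lborel. \<dots> x) = of_real (1 / sqrt (2 * pi)) * (LINT x|lborel. (of_real (exp (- (\<alpha> * x\<^sup>2))) * cis (t * x)))"
    by (rule integral_mult_right_zero)
  finally have "of_real (exp (- ((t / c)\<^sup>2 / 2))) = of_real (c / sqrt (2 * pi)) * (LINT x|lborel. (of_real (exp (- (\<alpha> * x\<^sup>2))) * cis (t * x)))"
    using c by (simp add: scaleR_conv_of_real)
  then have "of_real (sqrt (2 * pi) / c) * of_real (exp (- ((t / c)\<^sup>2 / 2))) = (LINT x|lborel. of_real (exp (- (\<alpha> * x\<^sup>2))) * cis (t * x))"
    using c by (simp add: field_simps)
  moreover have "sqrt (2 * pi) / c = sqrt (pi / \<alpha>)" using assms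
    by (simp add: c_def real_sqrt_mult real_sqrt_divide)
  moreover have "(t / c)\<^sup>2 / 2 = t\<^sup>2 / (4 * \<alpha>)" using c by (simp add: power_divide)
  ultimately show ?thesis by simp
qed

text \<open>Dominated convergence with |g| as majorant. It supplies the coefficients of
  \<open>poisson_summation\<close>, which are limits over growing intervals.\<close>

lemma integral_Icc_tendsto_LINT:
  fixes g :: "real \<Rightarrow> complex"
  assumes g: "integrable lborel g"
  shows "(\<lambda>R. integral {- real R - 1/2..real R + 1/2} g) \<longlonglongrightarrow> (LINT x|lborel. g x)"
proof -
  have [measurable]: "g \<in> borel_measurable borel" using g by auto
  have "(\<lambda>R. LINT x|lborel. indicator {- real R - 1/2..real R + 1/2} x *\<^sub>R g x) \<longlonglongrightarrow> (LINT x|lborel. g x)"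
  proof (rule integral_dominated_convergence)
    show "integrable lborel (\<lambda>x. norm (g x))" using g by simp
    show "AE x in lborel. (\<lambda>R. indicator {- real R - 1/2..real R + 1/2} x *\<^sub>R g x) \<longlonglongrightarrow> g x"
    proof (rule always_eventually, rule allI, rule tendsto_eventually)
      fix x
      show "\<forall>\<^sub>F R in sequentially. indicator {- real R - 1/2..real R + 1/2} x *\<^sub>R g x = g x"
        unfolding eventually_sequentially
      proof (intro exI allI impI)
        fix R assume "nat \<lceil>\<bar>x\<bar>\<rceil> \<le> R"
        then have "\<bar>x\<bar> \<le> real R" by linarith
        then have "x \<in> {- real R - 1/2..real R + 1/2}" by (simp add: abs_le_iff)
        then show "indicator {- real R - 1/2..real R + 1/2} x *\<^sub>R g x = g x" by simp
      qed
    qed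
  qed (auto simp: indicator_def)
  moreover have "(LINT x|lborel. indicator {a..b} x *\<^sub>R g x) = integral {a..b} g" for a b
    using set_borel_integral_eq_integral(2)[of "{a..b}" g] g
    unfolding set_lebesgue_integral_def set_integrable_def by (simp add: integrable_mult_indicator)
  ultimately show ?thesis by simp
qed

text \<open>From (|y| - 1)^2 >= 0 follows y^2 >= 2 |y| - 1. Replacing the square by a linear
  function turns Gaussian decay into geometric decay, so that summability reduces to a geometric
  series.\<close>

lemma gaussian_le_linear:
  fixes y :: real
  assumes "\<alpha> > 0" "z \<le> 2 * \<bar>y\<bar> - 1"
  shows "exp (- (\<alpha> * y\<^sup>2)) \<le> exp (- (\<alpha> * z))"
proof -
  have "(\<bar>y\<bar> - 1)\<^sup>2 \<ge> 0" by simp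
  then have "z \<le> y\<^sup>2" using assms by (simp add: power2_diff)
  then show ?thesis using assms by simp
qed

text \<open>Here u is the offset of a particle from its grid point and \<kappa> the frequency, both
  in mesh units. The offset enters the frequency side only through a phase of modulus 1.\<close>

lemma gaussian_poisson_summation:
  fixes \<alpha> u \<kappa> :: real
  assumes \<alpha>: "\<alpha> > 0" and u: "\<bar>u\<bar> \<le> 1/2"
  shows "(\<lambda>R. (\<Sum>n\<in>{- int R..int R}. of_real (exp (- (\<alpha> * (of_int n - u)\<^sup>2))) * cis (- (\<kappa> * (of_int n - u)))) -
    (\<Sum>m\<in>{- int R..int R}. of_real (sqrt (pi / \<alpha>) * exp (- ((\<kappa> + 2 * pi * of_int m)\<^sup>2 / (4 * \<alpha>)))) * cis (- (2 * pi * of_int m * u)))) \<longlonglongrightarrow> 0"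
proof -
  define f where "f x = of_real (exp (- (\<alpha> * (x - u)\<^sup>2))) * cis (- (\<kappa> * (x - u)))" for x
  define c where "c m = of_real (sqrt (pi / \<alpha>) * exp (- ((\<kappa> + 2 * pi * of_int m)\<^sup>2 / (4 * \<alpha>)))) * cis (- (2 * pi * of_int m * u))" for m :: int
  \<comment> \<open>Since |x| and |u| are at most 1/2, the translates by j and -j stay at distance
    at least j - 1 from u, and 2 (j - 1) - 1 = 2 j - 3. Likewise \<open>a2\<close> comes from
    |\<kappa> + 2 pi m| >= 2 pi j - |\<kappa>| for |m| = j.\<close>
  define a1 where "a1 j = exp (- (\<alpha> * (2 * real j - 3)))" for j
  define a2 where "a2 j = sqrt (pi / \<alpha>) * exp (- (1 / (4 * \<alpha>) * (4 * pi * real j - 2 * \<bar>\<kappa>\<bar> - 1)))" for j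
  have nn: "a1 j \<ge> 0" "a2 j \<ge> 0" for j using \<alpha> by (auto simp: a1_def a2_def)
  show ?thesis
    unfolding f_def[symmetric] c_def[symmetric]
  proof (rule poisson_summation)
    show "continuous_on UNIV f" unfolding f_def by (intro continuous_intros)
    show "norm (f (x + real j)) \<le> a1 j + a2 j \<and> norm (f (x - real j)) \<le> a1 j + a2 j"
      if "\<bar>x\<bar> \<le> 1/2" for x j
    proof -
      have "real j - 1 \<le> x + real j - u" "real j - 1 \<le> - (x - real j - u)"
        using that u by (simp_all add: abs_le_iff)
      then have "2 * real j - 3 \<le> 2 * \<bar>x + real j - u\<bar> - 1" "2 * real j - 3 \<le> 2 * \<bar>x - real j - u\<bar> - 1"
        using abs_ge_self[of "x + real j - u"] abs_ge_minus_self[of "x - real j - u"] by auto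
      from this[THEN gaussian_le_linear[OF \<alpha>]]
      have "norm (f (x + real j)) \<le> a1 j" "norm (f (x - real j)) \<le> a1 j"
        by (simp_all add: f_def a1_def norm_mult)
      then show ?thesis using nn[of j] by linarith
    qed
    show "norm (c (int j)) \<le> a1 j + a2 j \<and> norm (c (- int j)) \<le> a1 j + a2 j" for j
    proof -
      have "exp (- (1 / (4 * \<alpha>) * (\<kappa> + 2 * pi * of_int m)\<^sup>2)) \<le> exp (- (1 / (4 * \<alpha>) * (4 * pi * real j - 2 * \<bar>\<kappa>\<bar> - 1)))"
        if "\<bar>m\<bar> = int j" for m
      proof (rule gaussian_le_linear)
        have "real j = \<bar>of_int m\<bar>" using that by (metis of_int_abs of_int_of_nat_eq)
        then have "\<bar>2 * pi * of_int m\<bar> = 2 * pi * real j" by (simp add: abs_mult)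
        then have "2 * pi * real j - \<bar>\<kappa>\<bar> \<le> \<bar>\<kappa> + 2 * pi * of_int m\<bar>" by linarith
        then show "4 * pi * real j - 2 * \<bar>\<kappa>\<bar> - 1 \<le> 2 * \<bar>\<kappa> + 2 * pi * of_int m\<bar> - 1" by (auto simp: algebra_simps)
      qed (use \<alpha> in simp)
      then have "norm (c m) \<le> a2 j" if "\<bar>m\<bar> = int j" for m
        using that \<alpha> unfolding c_def a2_def by (simp add: norm_mult)
      from this[of "int j"] this[of "- int j"] show ?thesis using nn[of j] by simp
    qed
    show "summable (\<lambda>j. a1 j + a2 j)"
    proof (intro summable_add)
      have "a1 = (\<lambda>j. exp (3 * \<alpha>) * exp (- (2 * \<alpha>)) ^ j)"
        unfolding a1_def by (auto simp: exp_of_nat_mult[symmetric] exp_add[symmetric] algebra_simps)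
      then show "summable a1" using \<alpha> by (simp add: summable_mult summable_geometric)
      have "a2 = (\<lambda>j. sqrt (pi / \<alpha>) * exp ((2 * \<bar>\<kappa>\<bar> + 1) / (4 * \<alpha>)) * exp (- (pi / \<alpha>)) ^ j)"
        unfolding a2_def using \<alpha> by (auto simp: exp_of_nat_mult[symmetric] exp_add[symmetric] field_simps)
      then show "summable a2" using \<alpha> by (simp add: summable_mult summable_geometric)
    qed
    show "(\<lambda>R. integral {- real R - 1/2..real R + 1/2} (\<lambda>x. f x * cis (- (2 * pi * of_int m * x)))) \<longlonglongrightarrow> c m" for m
    proof -
      define g where "g y = of_real (exp (- (\<alpha> * y\<^sup>2))) * cis ((- (\<kappa> + 2 * pi * of_int m)) * y)" for y
      \<comment> \<open>Recentring at u leaves a centred Gaussian with frequency -(\<kappa> + 2 pi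
        m), and the remaining phase depends on u and m only.\<close>
      have eq: "f x * cis (- (2 * pi * of_int m * x)) = g (- u + 1 * x) * cis (- (2 * pi * of_int m * u))" for x
        by (simp add: f_def g_def mult.assoc cis_mult algebra_simps)
      have "integrable lborel (\<lambda>x. exp (- (\<alpha> * (x - 0)\<^sup>2)))"
        using has_bochner_integral_gaussian[OF \<alpha>, of 0] by (simp add: has_bochner_integral_iff)
      then have g: "integrable lborel g"
        by (rule Bochner_Integration.integrable_bound) (auto simp: g_def norm_mult intro!: borel_measurable_continuous_onI continuous_intros)
      have "(- (\<kappa> + 2 * pi * of_int m))\<^sup>2 = (\<kappa> + 2 * pi * of_int m)\<^sup>2" by (rule power2_minus)
      then have "(LINT x|lborel. f x * cis (- (2 * pi * of_int m * x))) = c m"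
        unfolding eq c_def using lborel_integral_real_affine[of 1 g "- u"] integral_gaussian_cis[OF \<alpha>, of "- (\<kappa> + 2 * pi * of_int m)"]
        by (simp add: g_def )
      moreover have "integrable lborel (\<lambda>x. f x * cis (- (2 * pi * of_int m * x)))"
        unfolding eq using lborel_integrable_real_affine[OF g, of 1 "- u"] by simp
      ultimately show ?thesis using integral_Icc_tendsto_LINT by metis
    qed
  qed
qed

section \<open>Aliases and truncation tail of a sampled Gaussian\<close>

text \<open>Dropping i^2 from (p + i)^2 gives geometric decay beyond the window edge. For \<alpha> =
  S / p^2 the leading factor is exp (- S) and the ratio is exp (- 2 S / p).\<close>

lemma gaussian_tail_term:
  fixes y :: real
  assumes "\<alpha> > 0" "p \<ge> 0" "y \<ge> p + real i"
  shows "exp (- (\<alpha> * y\<^sup>2)) \<le> exp (- (\<alpha> * p\<^sup>2)) * exp (- (2 * \<alpha> * p)) ^ i"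
proof -
  have "p\<^sup>2 + 2 * p * real i \<le> (p + real i)\<^sup>2" by (simp add: power2_sum)
  also have "\<dots> \<le> y\<^sup>2" using assms by (intro power_mono) auto
  finally have "- (\<alpha> * y\<^sup>2) \<le> - (\<alpha> * p\<^sup>2) + real i * (- (2 * \<alpha> * p))"
    using mult_left_mono[of "p\<^sup>2 + 2 * p * real i" "y\<^sup>2" \<alpha>] assms(1) by (simp add: algebra_simps)
  then show ?thesis by (simp add: exp_add[symmetric] exp_of_nat_mult[symmetric])
qed

text \<open>Natural subtraction gives exponent 0 both for j = p and for j = p + 1. The sum is
  therefore at most 1 plus a geometric series, whence the factor 2.\<close>

lemma sum_power_pred_le:
  fixes r :: real
  assumes "0 \<le> r" "r < 1"
  shows "(\<Sum>j\<le>R. if p \<le> j then r ^ (j - p - 1) else 0) \<le> 2 / (1 - r)"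
proof -
  have geo: "(\<Sum>i<n. r ^ i) \<le> 1 / (1 - r)" for n
    using assms by (simp add: sum_gp_strict divide_right_mono)
  have "(\<Sum>j\<le>R. if p \<le> j then r ^ (j - p - 1) else 0) = (\<Sum>j\<in>{p..R}. r ^ (j - p - 1))"
    by (intro sum.mono_neutral_cong_right) auto
  also have "\<dots> \<le> (\<Sum>j\<in>{p..p + (R + 1)}. r ^ (j - p - 1))"
    using assms by (intro sum_mono2) auto
  also have "\<dots> = (\<Sum>i\<in>{..R+1}. r ^ (i - 1))"
    by (rule sum.reindex_bij_witness[of _ "\<lambda>i. p + i" "\<lambda>j. j - p"]) auto
  also have "\<dots> = 1 + (\<Sum>i<R + 1. r ^ i)"
    by (simp only: Suc_eq_plus1[symmetric] sum.atMost_Suc_shift lessThan_Suc_atMost) simp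
  also have "\<dots> \<le> 1 / (1 - r) + 1 / (1 - r)"
    using assms geo[of "R + 1"] by (intro add_mono) auto
  finally show ?thesis by simp
qed

text \<open>Because of the offset, a point with |n| = p may already lie outside the window, so the
  tail starts at |n| = p. In general an outside point satisfies |n - u| >= p + (|n| - p - 1) with
  truncated subtraction. The factor 4 is 2 for the two signs of n times 2 for the repeated first
  term.\<close>

lemma gaussian_tail_sum:
  fixes \<alpha> u :: real
  assumes \<alpha>: "\<alpha> > 0" and u: "\<bar>u\<bar> \<le> 1/2" and p: "p \<ge> (1::nat)"
  shows "(\<Sum>n\<in>{- int R..int R}. if \<bar>of_int n - u\<bar> \<le> real p then 0 else exp (- (\<alpha> * (of_int n - u)\<^sup>2)))
    \<le> 4 * exp (- (\<alpha> * (real p)\<^sup>2)) / (1 - exp (- (2 * \<alpha> * real p)))"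
proof -
  define r where "r = exp (- (2 * \<alpha> * real p))"
  have r: "0 \<le> r" "r < 1" using \<alpha> p by (auto simp: r_def)
  define t where "t n = (if \<bar>of_int n - u\<bar> \<le> real p then 0 else exp (- (\<alpha> * (of_int n - u)\<^sup>2)))" for n :: int
  define b where "b j = exp (- (\<alpha> * (real p)\<^sup>2)) * (if p \<le> j then r ^ (j - p - 1) else 0)" for j
  have t_le: "t n \<le> b j" if "\<bar>n\<bar> = int j" for n j
  proof (cases "\<bar>of_int n - u\<bar> \<le> real p")
    case True
    then show ?thesis using r by (simp add: t_def b_def)
  next
    case False
    have j: "real j = \<bar>of_int n\<bar>" using that by (metis of_int_abs of_int_of_nat_eq)
    have "real j + 1/2 > real p" using False u j by linarith
    then have "p \<le> j" by linarith
    moreover have "\<bar>of_int n - u\<bar> \<ge> real p + real (j - p - 1)"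
    proof (cases "j - p - 1 = 0")
      case True
      then show ?thesis using False by simp
    next
      case False
      then have "real (j - p - 1) = real j - real p - 1" by (simp add: of_nat_diff)
      then show ?thesis using u j by linarith
    qed
    from gaussian_tail_term[OF \<alpha> _ this]
    have "exp (- (\<alpha> * (of_int n - u)\<^sup>2)) \<le> exp (- (\<alpha> * (real p)\<^sup>2)) * r ^ (j - p - 1)"
      by (simp add: r_def)
    ultimately show ?thesis using False by (simp add: t_def b_def)
  qed
  have "(\<Sum>n\<in>{- int R..int R}. t n) \<le> (\<Sum>j\<le>R. 2 * b j)"
    unfolding sum_int_symmetric
  proof (rule sum_mono)
    fix j
    have "t (int j) \<le> b j" "t (- int j) \<le> b j" "b j \<ge> 0" using t_le[of "int j" j] t_le[of "- int j" j] r by (auto simp: b_def)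
    then show "(if j = 0 then t 0 else t (int j) + t (- int j)) \<le> 2 * b j" by auto
  qed
  also have "\<dots> = 2 * exp (- (\<alpha> * (real p)\<^sup>2)) * (\<Sum>j\<le>R. if p \<le> j then r ^ (j - p - 1) else 0)"
    by (simp add: b_def sum_distrib_left mult.assoc)
  also have "\<dots> \<le> 2 * exp (- (\<alpha> * (real p)\<^sup>2)) * (2 / (1 - r))"
    by (intro mult_left_mono sum_power_pred_le r) auto
  finally show ?thesis by (simp add: t_def r_def)
qed

text \<open>Index j stands for the two aliases of order j + 1 and -(j + 1). Order 0 is left out
  because it is the exact transform; the common prefactor \<open>sqrt (pi / \<alpha>)\<close> is
  left out too.\<close>

definition gaussian_alias :: "real \<Rightarrow> real \<Rightarrow> nat \<Rightarrow> real" where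
  "gaussian_alias \<alpha> \<kappa> j = exp (- ((\<kappa> + 2 * pi * real (Suc j))\<^sup>2 / (4 * \<alpha>))) + exp (- ((\<kappa> - 2 * pi * real (Suc j))\<^sup>2 / (4 * \<alpha>)))"

lemma summable_gaussian_alias:
  assumes "\<alpha> > 0"
  shows "summable (gaussian_alias \<alpha> \<kappa>)"
proof (rule summable_comparison_test)
  define C where "C = exp ((2 * \<bar>\<kappa>\<bar> + 1) / (4 * \<alpha>))"
  have "exp (- (1 / (4 * \<alpha>) * y\<^sup>2)) \<le> C * exp (- (pi / \<alpha>)) ^ j"
    if "\<bar>y\<bar> \<ge> 2 * pi * real (Suc j) - \<bar>\<kappa>\<bar>" for j y
  proof -
    have "2 * pi * real j \<le> 2 * pi * real (Suc j)" by simp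
    then have "exp (- (1 / (4 * \<alpha>) * y\<^sup>2)) \<le> exp (- (1 / (4 * \<alpha>) * (4 * pi * real j - 2 * \<bar>\<kappa>\<bar> - 1)))"
      using assms that by (intro gaussian_le_linear; simp; linarith)
    also have "\<dots> = C * exp (- (pi / \<alpha>)) ^ j"
      unfolding C_def using assms by (auto simp: exp_of_nat_mult[symmetric] exp_add[symmetric] field_simps)
    finally show ?thesis .
  qed
  note b = this
  have "norm (gaussian_alias \<alpha> \<kappa> j) \<le> 2 * C * exp (- (pi / \<alpha>)) ^ j" for j
  proof -
    have "0 \<le> 2 * pi * real (Suc j)" by simp
    then have "\<bar>\<kappa> + 2 * pi * real (Suc j)\<bar> \<ge> 2 * pi * real (Suc j) - \<bar>\<kappa>\<bar>"
        "\<bar>\<kappa> - 2 * pi * real (Suc j)\<bar> \<ge> 2 * pi * real (Suc j) - \<bar>\<kappa>\<bar>" by linarith+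
    from this[THEN b] show ?thesis
      unfolding gaussian_alias_def by (simp add: abs_of_nonneg add_nonneg_nonneg)
  qed
  then show "\<exists>N. \<forall>n\<ge>N. norm (gaussian_alias \<alpha> \<kappa> n) \<le> 2 * C * exp (- (pi / \<alpha>)) ^ n" by blast
  show "summable (\<lambda>n. 2 * C * exp (- (pi / \<alpha>)) ^ n)"
    using assms by (intro summable_mult summable_geometric) simp
qed

text \<open>In the partial sums of Poisson summation the frequency m = 0 is the exact transform, the
  other frequencies are bounded by the aliases without their phases, and the grid points missing
  from the window form the tail. Neither bound depends on the cutoff R, so the remainder
  \<open>E R\<close> disappears in the limit.\<close>

lemma truncated_gaussian_trapezoid:
  fixes \<alpha> u \<kappa> :: real
  assumes \<alpha>: "\<alpha> > 0" and u: "\<bar>u\<bar> \<le> 1/2" and p: "p \<ge> (1::nat)"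
  shows "norm (of_real (sqrt (pi / \<alpha>) * exp (- (\<kappa>\<^sup>2 / (4 * \<alpha>)))) -
      (\<Sum>n\<in>{- int p..int p}. of_real (if \<bar>of_int n - u\<bar> \<le> real p then exp (- (\<alpha> * (of_int n - u)\<^sup>2)) else 0) *
        cis (- (\<kappa> * (of_int n - u)))))
    \<le> sqrt (pi / \<alpha>) * suminf (gaussian_alias \<alpha> \<kappa>) + 4 * exp (- (\<alpha> * (real p)\<^sup>2)) / (1 - exp (- (2 * \<alpha> * real p)))"
    (is "norm (?a - ?b) \<le> ?A + ?T")
proof (rule LIMSEQ_le_const)
  define s where "s n = of_real (exp (- (\<alpha> * (of_int n - u)\<^sup>2))) * cis (- (\<kappa> * (of_int n - u)))" for n :: int
  define c where "c m = of_real (sqrt (pi / \<alpha>) * exp (- ((\<kappa> + 2 * pi * of_int m)\<^sup>2 / (4 * \<alpha>)))) * cis (- (2 * pi * of_int m * u))" for m :: int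
  define E where "E R = (\<Sum>n\<in>{- int R..int R}. s n) - (\<Sum>n\<in>{- int R..int R}. c n)" for R
  have "E \<longlonglongrightarrow> 0" unfolding E_def s_def c_def using \<alpha> u by (rule gaussian_poisson_summation)
  then show "(\<lambda>R. ?A + ?T + norm (E R)) \<longlonglongrightarrow> ?A + ?T"
    using tendsto_add[OF tendsto_const tendsto_norm] by fastforce
  show "\<exists>N. \<forall>R\<ge>N. norm (?a - ?b) \<le> ?A + ?T + norm (E R)"
  proof (intro exI allI impI)
    fix R assume R: "p \<le> R"
    have "norm ((\<Sum>n\<in>{- int R..int R}. c n) - ?a) \<le> ?A"
    proof -
      have "?a = c 0" by (simp add: c_def)
      then have "(\<Sum>n\<in>{- int R..int R}. c n) - ?a = (\<Sum>j<R. c (int (Suc j)) + c (- int (Suc j)))"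
        unfolding sum_int_symmetric lessThan_Suc_atMost[symmetric] sum.lessThan_Suc_shift by simp
      also have "norm \<dots> \<le> (\<Sum>j<R. sqrt (pi / \<alpha>) * gaussian_alias \<alpha> \<kappa> j)"
      proof (rule sum_norm_le)
        fix j
        have "norm (c (int (Suc j)) + c (- int (Suc j))) \<le> norm (c (int (Suc j))) + norm (c (- int (Suc j)))"
          by (rule norm_triangle_ineq)
        also have "\<dots> = sqrt (pi / \<alpha>) * gaussian_alias \<alpha> \<kappa> j"
          using \<alpha> unfolding c_def norm_mult gaussian_alias_def by (simp add: norm_mult algebra_simps)
        finally show "norm (c (int (Suc j)) + c (- int (Suc j))) \<le> sqrt (pi / \<alpha>) * gaussian_alias \<alpha> \<kappa> j" .
      qed
      also have "\<dots> \<le> ?A"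
        unfolding sum_distrib_left[symmetric] using \<alpha>
        by (intro mult_left_mono sum_le_suminf summable_gaussian_alias) (auto simp: gaussian_alias_def add_nonneg_nonneg)
      finally show ?thesis .
    qed
    moreover have "norm ((\<Sum>n\<in>{- int R..int R}. s n) - ?b) \<le> ?T"
    proof -
      \<comment> \<open>Points with |n| > p have |n - u| > p, as |u| <= 1/2, so summing up to R
        instead of p adds only zeros.\<close>
      have "?b = (\<Sum>n\<in>{- int R..int R}. if \<bar>of_int n - u\<bar> \<le> real p then s n else 0)"
      proof (rule sum.mono_neutral_cong_left)
        show "\<forall>n\<in>{- int R..int R} - {- int p..int p}. (if \<bar>of_int n - u\<bar> \<le> real p then s n else 0) = 0"
        proof
          fix n assume "n \<in> {- int R..int R} - {- int p..int p}"
          then have "\<bar>n\<bar> \<ge> int p + 1" by auto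
          then have "\<bar>of_int n\<bar> \<ge> real p + 1" by linarith
          then show "(if \<bar>of_int n - u\<bar> \<le> real p then s n else 0) = 0" using u by auto
        qed
      qed (use R in \<open>auto simp: s_def\<close>)
      then have "(\<Sum>n\<in>{- int R..int R}. s n) - ?b = (\<Sum>n\<in>{- int R..int R}. if \<bar>of_int n - u\<bar> \<le> real p then 0 else s n)"
        unfolding sum_subtractf[symmetric] by (simp only:) (auto intro!: sum.cong simp flip: sum_subtractf)
      also have "norm \<dots> \<le> (\<Sum>n\<in>{- int R..int R}. if \<bar>of_int n - u\<bar> \<le> real p then 0 else exp (- (\<alpha> * (of_int n - u)\<^sup>2)))"
        by (rule sum_norm_le) (simp add: s_def norm_mult)
      also have "\<dots> \<le> ?T" using gaussian_tail_sum[OF \<alpha> u p] .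
      finally show ?thesis .
    qed
    moreover have "norm (((\<Sum>n\<in>{- int R..int R}. s n) - ?b) - ((\<Sum>n\<in>{- int R..int R}. c n) - ?a) - E R) \<le>
       norm ((\<Sum>n\<in>{- int R..int R}. s n) - ?b) + norm ((\<Sum>n\<in>{- int R..int R}. c n) - ?a) + norm (E R)"
      by (intro norm_triangle_le_diff add_mono norm_triangle_ineq4 order_refl)
    moreover have eq: "?a - ?b = ((\<Sum>n\<in>{- int R..int R}. s n) - ?b) - ((\<Sum>n\<in>{- int R..int R}. c n) - ?a) - E R"
      by (simp add: E_def)
    ultimately show "norm (?a - ?b) \<le> ?A + ?T + norm (E R)"
      unfolding eq by linarith
  qed
qed

section \<open>The complementary error function\<close>

lemma set_integrable_exp_minus_square:
  "A \<in> sets borel \<Longrightarrow> set_integrable lborel A (\<lambda>t::real. exp (- t\<^sup>2))"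
  unfolding set_integrable_def
  using has_bochner_integral_gaussian[of 1 0] by (intro integrable_mult_indicator) (auto simp: has_bochner_integral_iff)

lemma erfc_le_2: "erfc x \<le> 2"
proof -
  have "(LBINT t:{x..}. exp (- t\<^sup>2)) \<le> (LBINT t:UNIV. exp (- t\<^sup>2))"
    using set_integrable_exp_minus_square[of "{x..}"] set_integrable_exp_minus_square[of UNIV]
    unfolding set_lebesgue_integral_def set_integrable_def
    by (intro integral_mono) (auto simp: indicator_def)
  also have "\<dots> = sqrt pi"
    using has_bochner_integral_gaussian[of 1 0] by (simp add: set_lebesgue_integral_def has_bochner_integral_iff)
  finally show ?thesis by (simp add: erfc_def field_simps)
qed

text \<open>On the interval from x to x + 1 / x the integrand is at least its value at the right
  end. The length 1 / x gives the true order exp (- x^2) / x, because (x + 1 / x)^2 exceeds x^2 only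
  by 2 + 1 / x^2.\<close>

lemma erfc_lower_bound:
  assumes "x > 0"
  shows "2 / sqrt pi * (exp (- (x + 1 / x)\<^sup>2) / x) \<le> erfc x"
proof -
  have "exp (- (x + 1 / x)\<^sup>2) / x = (LBINT t:{x..x + 1/x}. exp (- (x + 1 / x)\<^sup>2))"
    using assms by (simp add: set_lebesgue_integral_def)
  also have "\<dots> \<le> (LBINT t:{x..x + 1/x}. exp (- t\<^sup>2))"
    using assms by (intro set_integral_mono set_integrable_exp_minus_square)
      (auto simp: set_integrable_def intro!: power_mono)
  also have "\<dots> \<le> (LBINT t:{x..}. exp (- t\<^sup>2))"
    using set_integrable_exp_minus_square[of "{x..}"] set_integrable_exp_minus_square[of "{x..x+1/x}"]
    unfolding set_lebesgue_integral_def set_integrable_def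
    by (intro integral_mono) (auto simp: indicator_def)
  finally show ?thesis unfolding erfc_def by (intro mult_left_mono) auto
qed

lemma exp_div_sqrt_le_erfc:
  assumes "c > 0" "S \<ge> c"
  shows "exp (- S) / sqrt S \<le> sqrt pi / 2 * exp (2 + 1 / c) * erfc (sqrt S)"
proof -
  have S: "S > 0" using assms by simp
  have "(sqrt S + 1 / sqrt S)\<^sup>2 = S + 2 + 1 / S"
    using S by (simp add: power2_sum power_divide)
  also have "1 / S \<le> 1 / c" using assms by (simp add: frac_le)
  finally have "exp (- S) / sqrt S \<le> exp (2 + 1 / c) * (exp (- (sqrt S + 1 / sqrt S)\<^sup>2) / sqrt S)"
    using S by (simp add: exp_add[symmetric] divide_right_mono)
  also have "\<dots> = sqrt pi / 2 * exp (2 + 1 / c) * (2 / sqrt pi * (exp (- (sqrt S + 1 / sqrt S)\<^sup>2) / sqrt S))"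
    by simp
  also have "\<dots> \<le> sqrt pi / 2 * exp (2 + 1 / c) * erfc (sqrt S)"
    using S by (intro mult_left_mono erfc_lower_bound) auto
  finally show ?thesis .
qed

lemma erfc_nonneg: "erfc x \<ge> 0"
  unfolding erfc_def set_lebesgue_integral_def by (intro mult_nonneg_nonneg Bochner_Integration.integral_nonneg) auto

text \<open>A consequence of exp x >= 1 + x. It controls the geometric factor of the tail when its
  ratio exp (- 2 S / p) is close to 1, that is for p large compared with S.\<close>

lemma inverse_one_minus_exp_le:
  fixes x :: real
  assumes "x > 0"
  shows "1 / (1 - exp (- x)) \<le> 1 + 1 / x"
proof -
  have "exp (- x) \<le> 1 / (1 + x)"
    using exp_ge_add_one_self[of x] assms by (simp add: exp_minus field_simps)
  then have "x / (1 + x) \<le> 1 - exp (- x)" using assms by (simp add: field_simps)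
  then have "1 / (1 - exp (- x)) \<le> 1 / (x / (1 + x))"
    using assms by (intro divide_left_mono) (auto simp: mult_pos_pos)
  then show ?thesis using assms by (simp add: field_simps)
qed

lemma sqrt_le_exp_half:
  fixes S :: real
  assumes "S \<ge> 0"
  shows "sqrt S \<le> exp (S / 2)"
proof (rule real_le_lsqrt)
  show "S \<le> (exp (S / 2))\<^sup>2"
  proof -
    have "S \<le> exp S" using exp_ge_add_one_self[of S] by linarith
    then show ?thesis by (simp add: exp_double[symmetric])
  qed
qed simp

text \<open>For \<open>S\<close> at most of the order of \<open>p\<close>, \<open>erfc (sqrt S)\<close> dominates the truncation error; for larger \<open>S\<close>
  it need not, but then \<open>E \<le> S / 2\<close> and the aliasing error is the larger one.\<close>

lemma tail_le_exp_plus_erfc: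
  assumes "c > 0" "S \<ge> c" "p \<ge> (1::nat)" "E \<le> pi\<^sup>2 * (real p)\<^sup>2 / S"
  shows "sqrt S / real p * (exp (- S) / (1 - exp (- (2 * S / real p)))) \<le>
    (1 + 3 * sqrt pi * exp (2 + 1 / c)) * (exp (- E) + erfc (sqrt S))"
proof -
  have S: "S > 0" using assms by simp
  define K where "K = sqrt pi / 2 * exp (2 + 1 / c)"
  have K: "K \<ge> 0" by (simp add: K_def)
  have 1: "exp (- S) / sqrt S \<le> K * erfc (sqrt S)"
    unfolding K_def using assms by (intro exp_div_sqrt_le_erfc) auto
  have 2: "sqrt S / real p * exp (- S) \<le> exp (- E) + 5 * K * erfc (sqrt S)"
  \<comment> \<open>The second case needs pi^2 p^2 / S <= S / 2, that is S >= sqrt 2 * pi * p, about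
    4.44 p. The threshold 5 leaves room for the crude bound pi < 3.5, since 3.5^2 / 25 =
    0.49.\<close>
  proof (cases "S \<le> 5 * real p")
    case True
    have "sqrt S / real p = (S / real p) / sqrt S"
      using real_div_sqrt[of S] S by (metis divide_divide_eq_left mult.commute less_imp_le)
    also have "\<dots> \<le> 5 / sqrt S"
      using True S assms by (intro divide_right_mono) (auto simp: field_simps)
    finally have "sqrt S / real p * exp (- S) \<le> 5 / sqrt S * exp (- S)" by (rule mult_right_mono) simp
    also have "\<dots> = 5 * (exp (- S) / sqrt S)" by simp
    also have "\<dots> \<le> 5 * (K * erfc (sqrt S))" by (rule mult_left_mono[OF 1]) simp
    finally have "sqrt S / real p * exp (- S) \<le> 5 * K * erfc (sqrt S)" by (simp only: mult.assoc)
    then show ?thesis by (smt (verit) exp_gt_zero)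
  next
    case False
    have "pi < 3.5" using pi_less_4 pi_approx by simp
    then have "pi\<^sup>2 \<le> 3.5\<^sup>2" by (intro power_mono) auto
    moreover have "(real p)\<^sup>2 \<le> (S / 5)\<^sup>2" using False by (intro power_mono) auto
    ultimately have "pi\<^sup>2 * (real p)\<^sup>2 \<le> 3.5\<^sup>2 * (S / 5)\<^sup>2" by (intro mult_mono) auto
    also have "\<dots> \<le> S / 2 * S" by (simp add: power2_eq_square)
    finally have "pi\<^sup>2 * (real p)\<^sup>2 / S \<le> S / 2" using S by (simp add: field_simps)
    with assms(4) have E: "E \<le> S / 2" by (rule order_trans)
    have "sqrt S / real p * exp (- S) \<le> sqrt S * exp (- S)"
      using assms S by (intro mult_right_mono) (auto simp: field_simps mult_le_cancel_left1)
    also have "\<dots> \<le> exp (S / 2) * exp (- S)" using S by (intro mult_right_mono sqrt_le_exp_half) auto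
    also have "\<dots> = exp (- (S / 2))" by (simp add: exp_add[symmetric])
    also have "\<dots> \<le> exp (- E)" using E by simp
    finally show ?thesis using K erfc_nonneg[of "sqrt S"] by (smt (verit) mult_nonneg_nonneg)
  qed
  have "sqrt S / real p * (exp (- S) / (1 - exp (- (2 * S / real p)))) =
      sqrt S / real p * exp (- S) * (1 / (1 - exp (- (2 * S / real p))))" by simp
  also have "\<dots> \<le> sqrt S / real p * exp (- S) * (1 + 1 / (2 * S / real p))"
    using S assms by (intro mult_left_mono inverse_one_minus_exp_le) auto
  \<comment> \<open>In the second summand p cancels, so it is of the order of erfc for every
    p.\<close>
  also have "\<dots> = sqrt S / real p * exp (- S) + exp (- S) / sqrt S / 2"
    using S assms by (simp add: field_simps) 
  also have "\<dots> \<le> exp (- E) + 5 * K * erfc (sqrt S) + K * erfc (sqrt S)"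
  proof (rule add_mono[OF 2])
    have "x / 2 \<le> y" if "0 \<le> x" "x \<le> y" for x y :: real using that by linarith
    from this[OF _ 1] show "exp (- S) / sqrt S / 2 \<le> K * erfc (sqrt S)" using S by simp
  qed
  also have "\<dots> = exp (- E) + 6 * K * erfc (sqrt S)" by (simp add: algebra_simps)
  also have "\<dots> \<le> (1 + 6 * K) * exp (- E) + (1 + 6 * K) * erfc (sqrt S)"
    using K erfc_nonneg[of "sqrt S"] by (intro add_mono mult_right_mono) (auto simp: mult_le_cancel_right1)
  finally show ?thesis by (simp add: K_def algebra_simps)
qed

section \<open>One alias against a mid-range Gaussian\<close>

text \<open>With a = H^2 / S, the factor exp (a k^2 / 4) is the division by the window transform. It
  cancels the k^2 term of the shifted window, so a Gaussian with the width of the mid-range one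
  remains, centred at - a G / s^2.\<close>

lemma nn_integral_gaussian_alias_term:
  fixes a s G :: real
  assumes "s > 0"
  shows "(\<integral>\<^sup>+k. ennreal (exp (- (s\<^sup>2 * k\<^sup>2 / 4)) * exp (a * k\<^sup>2 / 4) * exp (- (a * (k + G)\<^sup>2 / 4))) \<partial>lborel)
    = ennreal (2 * sqrt pi / s * exp (- (a * G\<^sup>2 * (s\<^sup>2 - a) / (4 * s\<^sup>2))))"
proof -
  have "- (s\<^sup>2 * k\<^sup>2 / 4) + a * k\<^sup>2 / 4 + - (a * (k + G)\<^sup>2 / 4) =
     - (a * G\<^sup>2 * (s\<^sup>2 - a) / (4 * s\<^sup>2)) + - (s\<^sup>2 / 4 * (k - (- (a * G / s\<^sup>2)))\<^sup>2)" for k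
    using assms by (simp add: field_simps power2_eq_square)
  then have eq: "exp (- (s\<^sup>2 * k\<^sup>2 / 4)) * exp (a * k\<^sup>2 / 4) * exp (- (a * (k + G)\<^sup>2 / 4)) =
     exp (- (a * G\<^sup>2 * (s\<^sup>2 - a) / (4 * s\<^sup>2))) * exp (- (s\<^sup>2 / 4 * (k - (- (a * G / s\<^sup>2)))\<^sup>2))" for k
    unfolding exp_add[symmetric] by simp
  have "sqrt (pi / (s\<^sup>2 / 4)) = 2 * sqrt pi / s"
    using assms by (simp add: real_sqrt_divide real_sqrt_mult)
  then show ?thesis
    unfolding eq using assms
    by (simp only: ennreal_mult exp_ge_zero) (subst nn_integral_cmult, simp, subst nn_integral_gaussian, simp, simp add: ennreal_mult[symmetric] mult.commute)
qed

section \<open>The one-dimensional gridding defect\<close>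

text \<open>The aliases plus the truncation error, for the half-width \<open>H = p h\<close>.\<close>

definition window1_defect :: "real \<Rightarrow> real \<Rightarrow> nat \<Rightarrow> real \<Rightarrow> real" where
  "window1_defect S h p k = h * (sqrt (pi / S) * real p * suminf (gaussian_alias (S / (real p)\<^sup>2) (k * h)) +
     4 * exp (- S) / (1 - exp (- (2 * S / real p))))"

lemma window1_defect_pos:
  assumes "S > 0" "h > 0" "p \<ge> 1"
  shows "window1_defect S h p k > 0"
proof -
  have "suminf (gaussian_alias (S / (real p)\<^sup>2) (k * h)) \<ge> 0"
    using assms by (intro suminf_nonneg summable_gaussian_alias) (auto simp: gaussian_alias_def add_nonneg_nonneg)
  then show ?thesis
    unfolding window1_defect_def using assms by (intro mult_pos_pos add_nonneg_pos mult_nonneg_nonneg divide_pos_pos) auto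
qed

lemma window1_hat_pos: "S > 0 \<Longrightarrow> H > 0 \<Longrightarrow> window1_hat S H k > 0"
  by (simp add: window1_hat_def)

text \<open>Everything is measured in mesh units: for H = p h the window at (n - u) h is a Gaussian
  in n - u with parameter S / p^2, cut off at p, and the frequency becomes k h.\<close>

lemma window1_defect_bound:
  assumes S: "S > 0" and h: "h > 0" and p: "p \<ge> 1" and H: "H = real p * h" and u: "\<bar>u\<bar> \<le> 1/2"
  shows "norm (of_real (window1_hat S H k) -
      of_real h * (\<Sum>n\<in>{- int p..int p}. of_real (window1 S H ((of_int n - u) * h)) * cis (- (k * ((of_int n - u) * h)))))
    \<le> window1_defect S h p k"
proof -
  define \<alpha> where "\<alpha> = S / (real p)\<^sup>2"
  have \<alpha>: "\<alpha> > 0" using S p by (simp add: \<alpha>_def)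
  have sq: "sqrt (pi / \<alpha>) = sqrt (pi / S) * real p"
    using p by (simp add: \<alpha>_def real_sqrt_divide real_sqrt_mult)
  have hat: "window1_hat S H k = h * (sqrt (pi / \<alpha>) * exp (- ((k * h)\<^sup>2 / (4 * \<alpha>))))"
    unfolding sq window1_hat_def H by (simp add: \<alpha>_def power_mult_distrib mult.commute)
  have w: "window1 S H ((of_int n - u) * h) = (if \<bar>of_int n - u\<bar> \<le> real p then exp (- (\<alpha> * (of_int n - u)\<^sup>2)) else 0)" for n
    using h p unfolding window1_def H \<alpha>_def by (simp add: abs_mult power_divide)
  have "of_real (window1_hat S H k) -
      of_real h * (\<Sum>n\<in>{- int p..int p}. of_real (window1 S H ((of_int n - u) * h)) * cis (- (k * ((of_int n - u) * h)))) =
    of_real h * (of_real (sqrt (pi / \<alpha>) * exp (- ((k * h)\<^sup>2 / (4 * \<alpha>)))) -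
      (\<Sum>n\<in>{- int p..int p}. of_real (if \<bar>of_int n - u\<bar> \<le> real p then exp (- (\<alpha> * (of_int n - u)\<^sup>2)) else 0) *
        cis (- (k * h * (of_int n - u)))))"
    unfolding hat w by (simp add: algebra_simps)
  also have "norm \<dots> \<le> h * (sqrt (pi / \<alpha>) * suminf (gaussian_alias \<alpha> (k * h)) + 4 * exp (- (\<alpha> * (real p)\<^sup>2)) / (1 - exp (- (2 * \<alpha> * real p))))"
    unfolding norm_mult using h truncated_gaussian_trapezoid[OF \<alpha> u p, of "k * h"] by simp
  also have "\<dots> = window1_defect S h p k"
    unfolding window1_defect_def sq using p by (simp add: \<alpha>_def power2_eq_square)
  finally show ?thesis .
qed

text \<open>One full exp (- E) is kept, and only the lower bound c is spent on the ratio: E (j +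
  1)^2 >= E + c j. Thus the first alias dominates the series with a constant depending on c
  alone.\<close>

lemma sum_exp_squares_le:
  fixes E c :: real
  assumes "c > 0" "E \<ge> c"
  shows "summable (\<lambda>j. exp (- (E * (real (Suc j))\<^sup>2)))"
    and "(\<Sum>j. exp (- (E * (real (Suc j))\<^sup>2))) \<le> exp (- E) / (1 - exp (- c))"
proof -
  have le: "exp (- (E * (real (Suc j))\<^sup>2)) \<le> exp (- E) * exp (- c) ^ j" for j
  proof -
    have "1 + real j \<le> (real (Suc j))\<^sup>2" by (simp add: power2_eq_square algebra_simps)
    then have "E * (1 + real j) \<le> E * (real (Suc j))\<^sup>2" using assms by (intro mult_left_mono) auto
    moreover have "c * real j \<le> E * real j" using assms by (intro mult_right_mono) auto
    ultimately have "- (E * (real (Suc j))\<^sup>2) \<le> - E + real j * (- c)" by (simp add: algebra_simps)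
    then show ?thesis by (simp add: exp_add[symmetric] exp_of_nat_mult[symmetric])
  qed
  have geo: "summable (\<lambda>j. exp (- E) * exp (- c) ^ j)"
    using assms by (intro summable_mult summable_geometric) auto
  show s: "summable (\<lambda>j. exp (- (E * (real (Suc j))\<^sup>2)))"
    by (rule summable_comparison_test'[OF geo, of 0]) (use le in auto)
  have "(\<Sum>j. exp (- (E * (real (Suc j))\<^sup>2))) \<le> (\<Sum>j. exp (- E) * exp (- c) ^ j)"
    by (rule suminf_le[OF le s geo])
  also have "\<dots> = exp (- E) / (1 - exp (- c))"
    using assms by (subst suminf_mult) (auto intro!: summable_geometric simp: suminf_geometric)
  finally show "(\<Sum>j. exp (- (E * (real (Suc j))\<^sup>2))) \<le> exp (- E) / (1 - exp (- c))" .
qed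

text \<open>The first summand comes from the alias series, with s >= sqrt \<mu>0; the second comes
  from the truncation, through the constant of \<open>tail_le_exp_plus_erfc\<close>.\<close>

definition defect_const :: "real \<Rightarrow> real \<Rightarrow> real" where
  "defect_const c \<mu>0 = 4 * sqrt pi / sqrt \<mu>0 / (1 - exp (- c)) + 8 / sqrt \<mu>0 * (1 + 3 * sqrt pi * exp (2 + 1 / c))"

lemma defect_const_nonneg: "c > 0 \<Longrightarrow> \<mu>0 > 0 \<Longrightarrow> defect_const c \<mu>0 \<ge> 0"
  by (simp add: defect_const_def)

text \<open>The truncation part of the defect is constant in k. After division by the window
  transform it meets exp (- \<mu> k^2 / 4), whose mass is bounded because \<mu> >= \<mu>0.
  Nonnegative integrals allow the alias series and the integral to be exchanged at once.\<close>

lemma nn_integral_window1_defect: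
  assumes c: "c > 0" "S \<ge> c" and h: "h > 0" and p: "p \<ge> 1" and H: "H = real p * h" and s: "s > 0"
    and \<mu>: "\<mu> = s\<^sup>2 - H\<^sup>2 / S" "\<mu> \<ge> \<mu>0" "\<mu>0 > 0"
    and E: "E = pi\<^sup>2 * \<mu> * (2 * real p)\<^sup>2 / (4 * s\<^sup>2 * S)" "E \<ge> c"
  shows "(\<integral>\<^sup>+k. ennreal (exp (- (s\<^sup>2 * k\<^sup>2 / 4)) * (window1_defect S h p k / window1_hat S H k)) \<partial>lborel)
    \<le> ennreal (defect_const c \<mu>0 * (exp (- E) + erfc (sqrt S)))"
proof -
  have S: "S > 0" using c by simp
  have Hp: "H > 0" using H h p by simp
  define \<alpha> where "\<alpha> = S / (real p)\<^sup>2"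
  have \<alpha>: "\<alpha> > 0" using S p by (simp add: \<alpha>_def)
  define a where "a = H\<^sup>2 / S"
  have a: "a \<ge> 0" "\<mu> = s\<^sup>2 - a" using S \<mu> by (auto simp: a_def)
  have sq: "sqrt \<mu>0 \<le> sqrt \<mu>" "sqrt \<mu> \<le> s" "sqrt \<mu>0 > 0"
    using \<mu> a s by (auto intro!: real_le_lsqrt)
  define G where "G j = 2 * pi * real (Suc j) / h" for j
  define A where "A = sqrt (pi / S) * real p"
  have A: "A > 0" using S p by (simp add: A_def)
  define X where "X = exp (- S) / (1 - exp (- (2 * S / real p)))"
  have "X \<ge> 0" unfolding X_def using S p by (intro divide_nonneg_nonneg) auto
  \<comment> \<open>The truncation error relative to \<open>A * h\<close>, the value of the window
    transform at 0.\<close>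
  define T where "T = 4 * X / A"
  have T: "T \<ge> 0" unfolding T_def using A \<open>X \<ge> 0\<close> by simp
  define g where "g k = exp (- (s\<^sup>2 * k\<^sup>2 / 4)) * exp (a * k\<^sup>2 / 4)" for k
  have al: "gaussian_alias \<alpha> (k * h) j = exp (- (a * (k + G j)\<^sup>2 / 4)) + exp (- (a * (k + - G j)\<^sup>2 / 4))" for k j
  proof -
    have "h * G j = 2 * pi * real (Suc j)" using h by (simp add: G_def)
    then have "k * h + 2 * pi * real (Suc j) = h * (k + G j)" "k * h - 2 * pi * real (Suc j) = h * (k + - G j)"
      by (simp_all add: distrib_left right_diff_distrib mult.commute)
    then have "(k * h + 2 * pi * real (Suc j))\<^sup>2 = h\<^sup>2 * (k + G j)\<^sup>2" "(k * h - 2 * pi * real (Suc j))\<^sup>2 = h\<^sup>2 * (k + - G j)\<^sup>2"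
      by (simp_all only: power_mult_distrib)
    moreover have "h\<^sup>2 * y / (4 * \<alpha>) = a * y / 4" for y
      using h S p by (simp add: \<alpha>_def a_def H power_mult_distrib field_simps)
    ultimately show ?thesis unfolding gaussian_alias_def by (simp only:)
  qed
  have quot: "window1_defect S h p k / window1_hat S H k = exp (a * k\<^sup>2 / 4) * (suminf (gaussian_alias \<alpha> (k * h)) + T)" for k
  proof -
    have "k\<^sup>2 * H\<^sup>2 / (4 * S) = a * k\<^sup>2 / 4" by (simp add: a_def mult.commute)
    then have "window1_hat S H k = sqrt (pi / S) * H * exp (- (a * k\<^sup>2 / 4))"
      by (simp only: window1_hat_def)
    then have hat: "window1_hat S H k = A * h / exp (a * k\<^sup>2 / 4)"
      by (simp only: A_def H exp_minus divide_inverse mult.assoc)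
    have "window1_defect S h p k = h * (A * suminf (gaussian_alias \<alpha> (k * h)) + 4 * X)"
      by (simp add: window1_defect_def A_def X_def \<alpha>_def)
    also have "4 * X = A * T" using A by (simp add: T_def)
    also have "h * (A * suminf (gaussian_alias \<alpha> (k * h)) + A * T) = A * h * (suminf (gaussian_alias \<alpha> (k * h)) + T)"
      by (simp only: distrib_left mult.assoc mult.left_commute)
    finally show ?thesis unfolding hat using A h by simp
  qed
  have nn: "gaussian_alias \<alpha> \<kappa> j \<ge> 0" for \<kappa> j by (simp add: gaussian_alias_def add_nonneg_nonneg)
  have meas[measurable]: "(\<lambda>k. gaussian_alias \<alpha> (k * h) j) \<in> borel_measurable borel" for j
    unfolding gaussian_alias_def by measurable
  have gm[measurable]: "g \<in> borel_measurable borel" unfolding g_def by measurable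
  have g_nn: "g k \<ge> 0" for k by (simp add: g_def)
  \<comment> \<open>The mesh width cancels: a G^2 equals pi^2 (2 p)^2 / S times (j + 1)^2. This is
    where the exponent of the theorem appears.\<close>
  have G2: "a * (G j)\<^sup>2 * (s\<^sup>2 - a) / (4 * s\<^sup>2) = E * (real (Suc j))\<^sup>2" for j
  proof -
    have "a * (G j)\<^sup>2 = pi\<^sup>2 * (2 * real p)\<^sup>2 / S * (real (Suc j))\<^sup>2"
      using h unfolding a_def G_def H power_mult_distrib power_divide by simp
    then show ?thesis unfolding E a(2) by (simp only:) (simp add: ac_simps)
  qed
  have alias_int: "(\<integral>\<^sup>+k. ennreal (g k * gaussian_alias \<alpha> (k * h) j) \<partial>lborel) = ennreal (4 * sqrt pi / s * exp (- (E * (real (Suc j))\<^sup>2)))" for j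
  proof -
    have "(\<integral>\<^sup>+k. ennreal (g k * gaussian_alias \<alpha> (k * h) j) \<partial>lborel) =
      (\<integral>\<^sup>+k. ennreal (g k * exp (- (a * (k + G j)\<^sup>2 / 4))) + ennreal (g k * exp (- (a * (k + - G j)\<^sup>2 / 4))) \<partial>lborel)"
      unfolding al by (intro nn_integral_cong) (simp add: distrib_left g_nn)
    also have "\<dots> = (\<integral>\<^sup>+k. ennreal (g k * exp (- (a * (k + G j)\<^sup>2 / 4))) \<partial>lborel) + (\<integral>\<^sup>+k. ennreal (g k * exp (- (a * (k + - G j)\<^sup>2 / 4))) \<partial>lborel)"
      by (rule nn_integral_add) auto
    also have "\<dots> = ennreal (2 * sqrt pi / s * exp (- (E * (real (Suc j))\<^sup>2))) + ennreal (2 * sqrt pi / s * exp (- (E * (real (Suc j))\<^sup>2)))"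
      unfolding g_def nn_integral_gaussian_alias_term[OF s] power2_minus G2 ..
    also have "\<dots> = ennreal (4 * sqrt pi / s * exp (- (E * (real (Suc j))\<^sup>2)))"
      using s by (simp add: ennreal_plus[symmetric] del: ennreal_plus)
    finally show ?thesis .
  qed
  have "(\<integral>\<^sup>+k. ennreal (exp (- (s\<^sup>2 * k\<^sup>2 / 4)) * (window1_defect S h p k / window1_hat S H k)) \<partial>lborel)
     = (\<integral>\<^sup>+k. (\<Sum>j. ennreal (g k * gaussian_alias \<alpha> (k * h) j)) + ennreal T * ennreal (exp (- (\<mu> / 4 * (k - 0)\<^sup>2))) \<partial>lborel)"
  proof (intro nn_integral_cong)
    fix k
    have gk: "g k = exp (- (\<mu> / 4 * (k - 0)\<^sup>2))"
      unfolding g_def exp_add[symmetric] a(2) by (simp add: left_diff_distrib diff_divide_distrib)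
    have "exp (- (s\<^sup>2 * k\<^sup>2 / 4)) * (window1_defect S h p k / window1_hat S H k) = (\<Sum>j. g k * gaussian_alias \<alpha> (k * h) j) + T * g k"
      unfolding quot suminf_mult[OF summable_gaussian_alias[OF \<alpha>]] by (simp add: g_def algebra_simps)
    then have eq: "exp (- (s\<^sup>2 * k\<^sup>2 / 4)) * (window1_defect S h p k / window1_hat S H k) =
       (\<Sum>j. g k * gaussian_alias \<alpha> (k * h) j) + T * exp (- (\<mu> / 4 * (k - 0)\<^sup>2))"
      by (simp only: gk[symmetric])
    show "ennreal (exp (- (s\<^sup>2 * k\<^sup>2 / 4)) * (window1_defect S h p k / window1_hat S H k)) = 
       (\<Sum>j. ennreal (g k * gaussian_alias \<alpha> (k * h) j)) + ennreal T * ennreal (exp (- (\<mu> / 4 * (k - 0)\<^sup>2)))"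
    proof -
      have sm: "summable (\<lambda>j. g k * gaussian_alias \<alpha> (k * h) j)"
        by (intro summable_mult summable_gaussian_alias \<alpha>)
      then have "(\<Sum>j. g k * gaussian_alias \<alpha> (k * h) j) \<ge> 0"
        by (rule suminf_nonneg) (simp add: nn g_nn)
      then show ?thesis
        unfolding eq using T sm by (subst suminf_ennreal2) (simp_all add: nn g_nn ennreal_mult)
    qed
  qed
  also have "\<dots> = (\<Sum>j. ennreal (4 * sqrt pi / s * exp (- (E * (real (Suc j))\<^sup>2)))) + ennreal T * ennreal (sqrt (pi / (\<mu> / 4)))"
    using \<mu> by (subst nn_integral_add, simp, simp, subst nn_integral_suminf, simp, simp only: alias_int, subst nn_integral_cmult, simp, subst nn_integral_gaussian, simp, simp)
  also have "\<dots> = ennreal (4 * sqrt pi / s * (\<Sum>j. exp (- (E * (real (Suc j))\<^sup>2))) + T * sqrt (pi / (\<mu> / 4)))"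
  proof -
    note sm = sum_exp_squares_le(1)[OF c(1) E(2)]
    have "(\<Sum>j. 4 * sqrt pi / s * exp (- (E * (real (Suc j))\<^sup>2))) = 4 * sqrt pi / s * (\<Sum>j. exp (- (E * (real (Suc j))\<^sup>2)))"
      by (rule suminf_mult[OF sm])
    moreover have "(\<Sum>j. exp (- (E * (real (Suc j))\<^sup>2))) \<ge> 0" by (rule suminf_nonneg[OF sm]) simp
    then have "4 * sqrt pi / s * (\<Sum>j. exp (- (E * (real (Suc j))\<^sup>2))) \<ge> 0"
      using s by (intro mult_nonneg_nonneg) auto
    moreover have "(\<Sum>j. ennreal (4 * sqrt pi / s * exp (- (E * (real (Suc j))\<^sup>2)))) = ennreal (\<Sum>j. 4 * sqrt pi / s * exp (- (E * (real (Suc j))\<^sup>2)))"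
      using s by (intro suminf_ennreal2 summable_mult sm) auto
    moreover have "sqrt (pi / (\<mu> / 4)) \<ge> 0" using \<mu>(2,3) by simp
    ultimately show ?thesis using T by (simp only: ennreal_plus ennreal_mult mult_nonneg_nonneg)
  qed
  also have "\<dots> \<le> ennreal (defect_const c \<mu>0 * (exp (- E) + erfc (sqrt S)))"
  proof (rule ennreal_leI)
    have "4 * sqrt pi / s * (\<Sum>j. exp (- (E * (real (Suc j))\<^sup>2))) \<le> 4 * sqrt pi / sqrt \<mu>0 * (exp (- E) / (1 - exp (- c)))"
      using sum_exp_squares_le[OF c(1) E(2)] sq order_trans[OF sq(1,2)] c s
      by (intro mult_mono divide_left_mono suminf_nonneg) auto
    also have "\<dots> = 4 * sqrt pi / sqrt \<mu>0 / (1 - exp (- c)) * exp (- E)" by simp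
    also have "\<dots> \<le> 4 * sqrt pi / sqrt \<mu>0 / (1 - exp (- c)) * (exp (- E) + erfc (sqrt S))"
      using c \<mu> erfc_nonneg by (intro mult_left_mono) auto
    finally have 1: "4 * sqrt pi / s * (\<Sum>j. exp (- (E * (real (Suc j))\<^sup>2))) \<le> 4 * sqrt pi / sqrt \<mu>0 / (1 - exp (- c)) * (exp (- E) + erfc (sqrt S))" .
    \<comment> \<open>Since \<mu> <= s^2, the exponent is at most pi^2 p^2 / S, which is what lets
      the aliasing term absorb the truncation for large S.\<close>
    have EE: "E \<le> pi\<^sup>2 * (real p)\<^sup>2 / S"
    proof -
      have "\<mu> / s\<^sup>2 \<le> 1" using a s by simp
      then have "(pi\<^sup>2 * (real p)\<^sup>2 / S) * (\<mu> / s\<^sup>2) \<le> (pi\<^sup>2 * (real p)\<^sup>2 / S) * 1" using S by (intro mult_left_mono) auto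
      then show ?thesis unfolding E by (simp add: power_mult_distrib field_simps)
    qed
    \<comment> \<open>The constant 8 is the 4 of the tail bound times the 2 in sqrt (4 pi / \<mu>);
      sqrt pi cancels against \<open>A\<close>.\<close>
    have "T * sqrt (pi / (\<mu> / 4)) = 8 / sqrt \<mu> * (sqrt S / real p * X)"
      unfolding T_def A_def using S p \<mu>(2,3) by (simp add: real_sqrt_divide real_sqrt_mult field_simps)
    also have "\<dots> \<le> 8 / sqrt \<mu>0 * ((1 + 3 * sqrt pi * exp (2 + 1 / c)) * (exp (- E) + erfc (sqrt S)))"
    proof (rule mult_mono)
      show "sqrt S / real p * X \<le> (1 + 3 * sqrt pi * exp (2 + 1 / c)) * (exp (- E) + erfc (sqrt S))"
        unfolding X_def by (rule tail_le_exp_plus_erfc[OF c p EE])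
      show "8 / sqrt \<mu> \<le> 8 / sqrt \<mu>0" using \<mu>(2,3) by (intro divide_left_mono) auto
    qed (use \<open>X \<ge> 0\<close> S \<mu>(3) in auto)
    finally show "4 * sqrt pi / s * (\<Sum>j. exp (- (E * (real (Suc j))\<^sup>2))) + T * sqrt (pi / (\<mu> / 4)) \<le> defect_const c \<mu>0 * (exp (- E) + erfc (sqrt S))"
      using 1 unfolding defect_const_def by (simp only: distrib_right mult.assoc add_mono)
  qed
  finally show ?thesis .
qed

section \<open>The three-dimensional defect\<close>

text \<open>Telescoping: one factor is exchanged at a time. Every other factor is bounded by a +
  \<delta>, which covers both x and y, so each summand is a plain product and can be integrated
  coordinatewise.\<close>

lemma norm_prod_diff_le:
  fixes x y :: "'i \<Rightarrow> 'a::real_normed_field"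
  assumes "finite A" and "\<And>i. i \<in> A \<Longrightarrow> norm (x i) \<le> a i" and "\<And>i. i \<in> A \<Longrightarrow> norm (x i - y i) \<le> \<delta> i"
  shows "norm ((\<Prod>i\<in>A. x i) - (\<Prod>i\<in>A. y i)) \<le> (\<Sum>d\<in>A. \<Prod>i\<in>A. if i = d then \<delta> i else a i + \<delta> i)"
  using assms
proof (induction A rule: finite_induct)
  case (insert j F)
  have nn: "0 \<le> a i" "0 \<le> \<delta> i" if "i \<in> insert j F" for i
    using insert.prems[OF that] norm_ge_zero order_trans by blast+
  have y: "norm (y j) \<le> a j + \<delta> j"
    using insert.prems[of j] norm_triangle_ineq4[of "x j" "x j - y j"] by simp
  have x: "norm (\<Prod>i\<in>F. x i) \<le> (\<Prod>i\<in>F. a i + \<delta> i)"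
    unfolding prod_norm[symmetric]
  proof (rule prod_mono)
    fix i assume "i \<in> F"
    then show "0 \<le> norm (x i) \<and> norm (x i) \<le> a i + \<delta> i"
      using insert.prems(1)[of i] nn(2)[of i] by simp
  qed
  have "(\<Prod>i\<in>insert j F. x i) - (\<Prod>i\<in>insert j F. y i) =
      (x j - y j) * (\<Prod>i\<in>F. x i) + y j * ((\<Prod>i\<in>F. x i) - (\<Prod>i\<in>F. y i))"
    using insert.hyps by (simp add: algebra_simps)
  also have "norm \<dots> \<le> norm (x j - y j) * norm (\<Prod>i\<in>F. x i) + norm (y j) * norm ((\<Prod>i\<in>F. x i) - (\<Prod>i\<in>F. y i))"
    by (metis norm_mult norm_triangle_ineq)
  also have "\<dots> \<le> \<delta> j * (\<Prod>i\<in>F. a i + \<delta> i) + (a j + \<delta> j) * (\<Sum>d\<in>F. \<Prod>i\<in>F. if i = d then \<delta> i else a i + \<delta> i)"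
    using insert.prems nn x y insert.IH by (intro add_mono mult_mono) auto
  also have "(a j + \<delta> j) * (\<Sum>d\<in>F. \<Prod>i\<in>F. if i = d then \<delta> i else a i + \<delta> i) =
      (\<Sum>d\<in>F. \<Prod>i\<in>insert j F. if i = d then \<delta> i else a i + \<delta> i)"
    unfolding sum_distrib_left using insert.hyps by (intro sum.cong) auto
  also have "(\<Prod>i\<in>F. a i + \<delta> i) = (\<Prod>i\<in>F. if i = j then \<delta> i else a i + \<delta> i)"
    using insert.hyps by (intro prod.cong) auto
  finally show ?case using insert.hyps by simp
qed simp

text \<open>Tonelli's theorem, carried over from basis vectors to component indices.\<close>

lemma nn_integral_lborel_vec_prod:
  fixes f :: "'n::finite \<Rightarrow> real \<Rightarrow> ennreal"
  assumes [measurable]: "\<And>i. f i \<in> borel_measurable borel"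
  shows "(\<integral>\<^sup>+x. (\<Prod>i\<in>UNIV. f i (x $ i)) \<partial>(lborel :: (real ^ 'n) measure)) = (\<Prod>i\<in>UNIV. \<integral>\<^sup>+t. f i t \<partial>lborel)"
proof -
  have prod_Basis: "(\<Prod>b\<in>(Basis :: (real ^ 'n) set). G b) = (\<Prod>i\<in>UNIV. G (axis i 1))" for G :: "real ^ 'n \<Rightarrow> ennreal"
  proof -
    have B: "(Basis :: (real ^ 'n) set) = range (\<lambda>i. axis i 1)" by (auto simp: Basis_vec_def)
    show ?thesis unfolding B by (subst prod.reindex) (auto simp: inj_on_def axis_eq_axis)
  qed
  show ?thesis
    using nn_integral_lborel_prod[where f = "\<lambda>b :: real ^ 'n. f (axis_index b)"]
    by (simp add: prod_Basis inner_axis)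
qed

lemma sum_stencil_prod:
  fixes \<phi> :: "3 \<Rightarrow> int \<Rightarrow> 'a::comm_semiring_1"
  assumes P: "\<And>d. real (P $ d) = 2 * real (p d) + 1"
  shows "(\<Sum>n\<in>stencil P. \<Prod>d\<in>UNIV. \<phi> d (n $ d)) = (\<Prod>d\<in>UNIV. \<Sum>n\<in>{- int (p d)..int (p d)}. \<phi> d n)"
proof -
  have "real_of_int \<bar>z\<bar> \<le> (real (P $ d) - 1) / 2 \<longleftrightarrow> z \<in> {- int (p d)..int (p d)}" for z d
    unfolding P by (auto simp: abs_le_iff)
  then have st: "stencil P = {n. \<forall>d. n $ d \<in> {- int (p d)..int (p d)}}" unfolding stencil_def by blast
  have "(\<Prod>d\<in>UNIV. \<Sum>n\<in>{- int (p d)..int (p d)}. \<phi> d n) = (\<Sum>g\<in>(\<Pi>\<^sub>E d\<in>UNIV. {- int (p d)..int (p d)}). \<Prod>d\<in>UNIV. \<phi> d (g d))"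
    by (rule prod_sum_PiE) auto
  also have "\<dots> = (\<Sum>n\<in>stencil P. \<Prod>d\<in>UNIV. \<phi> d (n $ d))"
    unfolding st by (rule sum.reindex_bij_witness[of _ "\<lambda>n d. n $ d" "\<lambda>g. \<chi> d. g d"]) (auto simp: PiE_def)
  finally show ?thesis ..
qed

text \<open>Moving the grid point by one step along d changes a single coordinate, so the comparison
  of distances reduces to that coordinate. The steps 1 and -1 give the two inequalities for the
  absolute value.\<close>

lemma nearest_in_uniform_grid:
  fixes h x0 x y :: "real ^ 3"
  assumes "nearest_in (uniform_grid x0 h) x y" and h: "\<And>d. h $ d > 0"
  shows "\<bar>x $ d - y $ d\<bar> \<le> h $ d / 2"
proof -
  obtain n where y: "y = x0 + mesh_shift h n" and near: "\<And>m. dist x y \<le> dist x (x0 + mesh_shift h m)"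
    using assms unfolding nearest_in_def uniform_grid_def by auto
  define v where "v = x - y"
  have shift: "(v $ d)\<^sup>2 \<le> (v $ d - of_int s * h $ d)\<^sup>2" for s :: int
  proof -
    define m where "m = (\<chi> i. if i = d then n $ i + s else n $ i)"
    have m: "(x - (x0 + mesh_shift h m)) $ i = (if i = d then v $ d - of_int s * h $ d else v $ i)" for i
      by (auto simp: v_def y m_def mesh_shift_def algebra_simps)
    have "(norm v)\<^sup>2 \<le> (norm (x - (x0 + mesh_shift h m)))\<^sup>2"
      using near[of m] unfolding dist_norm v_def by (intro power_mono) auto
    then have "(\<Sum>i\<in>UNIV. (v $ i)\<^sup>2) \<le> (\<Sum>i\<in>UNIV. (if i = d then v $ d - of_int s * h $ d else v $ i)\<^sup>2)"
      unfolding power2_norm_eq_inner inner_vec_def m by (simp add: power2_eq_square)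
    then show ?thesis by (simp add: sum.remove[of UNIV d])
  qed
  have "\<bar>v $ d\<bar> \<le> h $ d / 2"
  proof -
    have "h $ d * (h $ d - 2 * v $ d) \<ge> 0" "h $ d * (h $ d + 2 * v $ d) \<ge> 0"
      using shift[of 1] shift[of "-1"] by (simp_all add: power2_eq_square algebra_simps)
    then show ?thesis using h[of d] by (simp add: zero_le_mult_iff abs_le_iff not_le)
  qed
  then show ?thesis by (simp add: v_def)
qed

lemma exp_inner_eq_prod_cis:
  fixes k v :: "real ^ 'n::finite"
  shows "exp (- \<i> * of_real (k \<bullet> v)) = (\<Prod>d\<in>UNIV. cis (- (k $ d * v $ d)))"
  by (simp add: inner_vec_def sum_distrib_left exp_sum cis_conv_exp flip: sum_negf)

text \<open>The formula involves neither the particle index nor its grid point, so it can serve as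
  the common normalization M in \<open>debye_hueckel\<close>.\<close>

definition defect_bound :: "real \<Rightarrow> real ^ 3 \<Rightarrow> real ^ 3 \<Rightarrow> (3 \<Rightarrow> nat) \<Rightarrow> real ^ 3 \<Rightarrow> real" where
  "defect_bound S H h p k = (\<Sum>d\<in>UNIV. \<Prod>i\<in>UNIV. if i = d then window1_defect S (h $ i) (p i) (k $ i)
     else window1_hat S (H $ i) (k $ i) + window1_defect S (h $ i) (p i) (k $ i))"

lemma norm_grid_defect_le:
  fixes h H :: "real ^ 3"
  assumes S: "S > 0" and h: "\<And>d. h $ d > 0" and p: "\<And>d. p d \<ge> 1" and H: "\<And>d. H $ d = real (p d) * h $ d"
    and P: "\<And>d. real (P $ d) = 2 * real (p d) + 1" and near: "nearest_in (uniform_grid x0 h) (r j) (rbar j)"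
  shows "norm (grid_defect S H h P r rbar j k) \<le> defect_bound S H h p k"
proof -
  define u where "u d = (r j $ d - rbar j $ d) / h $ d" for d
  have u: "\<bar>u d\<bar> \<le> 1/2" for d
    using nearest_in_uniform_grid[OF near h, of d] h[of d] by (simp add: u_def field_simps)
  have pos: "(rbar j + mesh_shift h n - r j) $ d = (of_int (n $ d) - u d) * h $ d" for n d
  proof -
    have "u d * h $ d = r j $ d - rbar j $ d" using h[of d] by (simp add: u_def)
    then show ?thesis by (simp add: mesh_shift_def left_diff_distrib)
  qed
  define y where "y d = complex_of_real (h $ d) * (\<Sum>n\<in>{- int (p d)..int (p d)}.
     of_real (window1 S (H $ d) ((of_int n - u d) * h $ d)) * cis (- (k $ d * ((of_int n - u d) * h $ d))))" for d
  \<comment> \<open>Window, phase and cell volume factor over the coordinates and the stencil is a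
    box, so the three-dimensional sum is a product of one-dimensional ones.\<close>
  have "grid_defect S H h P r rbar j k = (\<Prod>d\<in>UNIV. of_real (window1_hat S (H $ d) (k $ d))) - (\<Prod>d\<in>UNIV. y d)"
    unfolding grid_defect_def window_hat_def window_def cell_volume_def exp_inner_eq_prod_cis of_real_prod
      prod.distrib[symmetric] pos y_def
    by (subst sum_stencil_prod[OF P]) (simp only: prod.distrib)
  also have "norm \<dots> \<le> defect_bound S H h p k"
    unfolding defect_bound_def
  proof (rule norm_prod_diff_le)
    fix d
    have "H $ d > 0" using H p[of d] h[of d] by simp
    then show "norm (complex_of_real (window1_hat S (H $ d) (k $ d))) \<le> window1_hat S (H $ d) (k $ d)"
      using window1_hat_pos[OF S] by (simp add: less_imp_le)
    show "norm (of_real (window1_hat S (H $ d) (k $ d)) - y d) \<le> window1_defect S (h $ d) (p d) (k $ d)"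
      unfolding y_def by (rule window1_defect_bound[OF S h p H u])
  qed simp
  finally show ?thesis .
qed

lemma window1_defect_measurable[measurable]:
  "S > 0 \<Longrightarrow> p \<ge> 1 \<Longrightarrow> window1_defect S h p \<in> borel_measurable borel"
  unfolding window1_defect_def[abs_def] gaussian_alias_def by measurable

lemma window1_hat_measurable[measurable]: "window1_hat S H \<in> borel_measurable borel"
  unfolding window1_hat_def[abs_def] by measurable

lemma window_hat_pos: "S > 0 \<Longrightarrow> (\<And>d. H $ d > 0) \<Longrightarrow> window_hat S H k > 0"
  unfolding window_hat_def by (intro prod_pos) (simp add: window1_hat_pos)

lemma defect_bound_pos:
  assumes "S > 0" "\<And>d. h $ d > 0" "\<And>d. p d \<ge> 1" "\<And>d. H $ d > 0"
  shows "defect_bound S H h p k > 0"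
  unfolding defect_bound_def using assms
  by (intro sum_pos prod_pos) (auto intro!: window1_defect_pos add_pos_pos window1_hat_pos)

text \<open>In the summand d, coordinate d supplies the small factor and the two others only need to
  stay bounded. Their bound adds the Gaussian mass 2 sqrt pi / s and the defect integral; the 3 is
  the crude bound exp (- E) + erfc <= 1 + 2.\<close>

lemma nn_integral_defect_bound:
  fixes h H :: "real ^ 3" and E \<mu> :: "3 \<Rightarrow> real"
  assumes c: "c > 0" "S \<ge> c" and h: "\<And>d. h $ d > 0" and p: "\<And>d. p d \<ge> 1" and H: "\<And>d. H $ d = real (p d) * h $ d"
    and s: "s > 0" and \<mu>: "\<And>d. \<mu> d = s\<^sup>2 - (H $ d)\<^sup>2 / S" "\<And>d. \<mu> d \<ge> \<mu>0" "\<mu>0 > 0"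
    and E: "\<And>d. E d = pi\<^sup>2 * \<mu> d * (2 * real (p d))\<^sup>2 / (4 * s\<^sup>2 * S)" "\<And>d. E d \<ge> c"
  shows "(\<integral>\<^sup>+k. ennreal (exp (- (s\<^sup>2 * (norm k)\<^sup>2 / 4)) * (defect_bound S H h p k / window_hat S H k)) \<partial>lborel)
    \<le> ennreal (defect_const c \<mu>0 * (2 * sqrt pi / sqrt \<mu>0 + 3 * defect_const c \<mu>0)\<^sup>2 * (\<Sum>d\<in>UNIV. exp (- E d) + erfc (sqrt S)))"
proof -
  have S: "S > 0" using c by simp
  have Hp: "H $ d > 0" for d using H p[of d] h[of d] by simp
  define D where "D = defect_const c \<mu>0"
  have D: "D \<ge> 0" unfolding D_def using c(1) \<mu>(3) by (rule defect_const_nonneg)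
  define M where "M = 2 * sqrt pi / sqrt \<mu>0 + 3 * D"
  have M: "M \<ge> 0" using D \<mu>(3) by (simp add: M_def)
  define \<delta> where "\<delta> i = window1_defect S (h $ i) (p i)" for i
  define a where "a i = window1_hat S (H $ i)" for i
  have [measurable]: "\<delta> i \<in> borel_measurable borel" "a i \<in> borel_measurable borel" for i
    using S p by (auto simp: \<delta>_def a_def)
  have \<delta>: "\<delta> i t > 0" for i t unfolding \<delta>_def by (rule window1_defect_pos[OF S h p])
  have a: "a i t > 0" for i t unfolding a_def by (rule window1_hat_pos[OF S Hp])
  define X where "X d = exp (- E d) + erfc (sqrt S)" for d
  have X: "0 \<le> X d" "X d \<le> 3" for d
  proof -
    have "exp (- E d) \<le> 1" using E(2)[of d] c by simp
    then show "0 \<le> X d" "X d \<le> 3" using erfc_nonneg[of "sqrt S"] erfc_le_2[of "sqrt S"] exp_ge_zero[of "- E d"]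
      unfolding X_def by linarith+
  qed
  define F where "F d i t = exp (- (s\<^sup>2 * t\<^sup>2 / 4)) * ((if i = d then \<delta> i t else a i t + \<delta> i t) / a i t)" for d i t
  have F: "F d i t \<ge> 0" for d i t
    unfolding F_def using \<delta>[of i t] a[of i t] by (intro mult_nonneg_nonneg divide_nonneg_nonneg) auto
  have [measurable]: "F d i \<in> borel_measurable borel" for d i
    unfolding F_def[abs_def] by (cases "i = d") simp_all
  have int_\<delta>: "(\<integral>\<^sup>+t. ennreal (exp (- (s\<^sup>2 * t\<^sup>2 / 4)) * (\<delta> i t / a i t)) \<partial>lborel) \<le> ennreal (D * X i)" for i
    unfolding \<delta>_def a_def D_def X_def
    by (rule nn_integral_window1_defect[OF c h p H s \<mu>(1,2,3) E])
  have int_diag: "(\<integral>\<^sup>+t. ennreal (F d d t) \<partial>lborel) \<le> ennreal (D * X d)" for d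
    using int_\<delta>[of d] by (simp add: F_def)
  have int_off: "(\<integral>\<^sup>+t. ennreal (F d i t) \<partial>lborel) \<le> ennreal M" if "i \<noteq> d" for d i
  proof -
    have "(\<integral>\<^sup>+t. ennreal (F d i t) \<partial>lborel) =
        (\<integral>\<^sup>+t. ennreal (exp (- (s\<^sup>2 / 4 * (t - 0)\<^sup>2))) + ennreal (exp (- (s\<^sup>2 * t\<^sup>2 / 4)) * (\<delta> i t / a i t)) \<partial>lborel)"
    proof (intro nn_integral_cong)
      fix t
      have "F d i t = exp (- (s\<^sup>2 / 4 * (t - 0)\<^sup>2)) + exp (- (s\<^sup>2 * t\<^sup>2 / 4)) * (\<delta> i t / a i t)"
        using that a[of i t] by (simp add: F_def add_divide_distrib distrib_left)
      then show "ennreal (F d i t) = ennreal (exp (- (s\<^sup>2 / 4 * (t - 0)\<^sup>2))) + ennreal (exp (- (s\<^sup>2 * t\<^sup>2 / 4)) * (\<delta> i t / a i t))"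
        using \<delta>[of i t] a[of i t] by (simp add: less_imp_le)
    qed
    also have "\<dots> = ennreal (sqrt (pi / (s\<^sup>2 / 4))) + (\<integral>\<^sup>+t. ennreal (exp (- (s\<^sup>2 * t\<^sup>2 / 4)) * (\<delta> i t / a i t)) \<partial>lborel)"
      using s by (subst nn_integral_add, simp, simp, subst nn_integral_gaussian) simp_all
    also have "\<dots> \<le> ennreal (sqrt (pi / (s\<^sup>2 / 4))) + ennreal (D * X i)"
      by (intro add_left_mono int_\<delta>)
    also have "\<dots> = ennreal (2 * sqrt pi / s + D * X i)"
      using s D X(1)[of i] by (simp add: real_sqrt_divide real_sqrt_mult)
    also have "\<dots> \<le> ennreal M"
    proof (rule ennreal_leI)
      have "\<mu>0 \<le> s\<^sup>2" using \<mu>(1,2)[of i] S by (smt (verit) divide_nonneg_pos zero_le_power2)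
      then have "sqrt \<mu>0 \<le> s" using s by (intro real_le_lsqrt) auto
      then have "2 * sqrt pi / s \<le> 2 * sqrt pi / sqrt \<mu>0"
        using \<mu>(3) s by (intro divide_left_mono) auto
      moreover have "D * X i \<le> D * 3" by (intro mult_left_mono X D)
      ultimately show "2 * sqrt pi / s + D * X i \<le> M" by (simp add: M_def)
    qed
    finally show ?thesis .
  qed
  have split: "exp (- (s\<^sup>2 * (norm k)\<^sup>2 / 4)) * (defect_bound S H h p k / window_hat S H k) = (\<Sum>d\<in>UNIV. \<Prod>i\<in>UNIV. F d i (k $ i))" for k
  proof -
    have "exp (- (s\<^sup>2 * (norm k)\<^sup>2 / 4)) = (\<Prod>i\<in>UNIV. exp (- (s\<^sup>2 * (k $ i)\<^sup>2 / 4)))"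
      unfolding power2_norm_eq_inner inner_vec_def
      by (simp add: exp_sum[symmetric] sum_negf sum_distrib_left sum_divide_distrib power2_eq_square)
    then show ?thesis
      unfolding defect_bound_def window_hat_def F_def prod.distrib prod_dividef sum_divide_distrib sum_distrib_left \<delta>_def a_def
      by simp
  qed
  have "(\<integral>\<^sup>+k. ennreal (exp (- (s\<^sup>2 * (norm k)\<^sup>2 / 4)) * (defect_bound S H h p k / window_hat S H k)) \<partial>lborel) =
      (\<integral>\<^sup>+k. (\<Sum>d\<in>UNIV. \<Prod>i\<in>UNIV. ennreal (F d i (k $ i))) \<partial>lborel)"
    unfolding split by (intro nn_integral_cong) (simp add: prod_ennreal sum_ennreal F prod_nonneg)
  also have "\<dots> = (\<Sum>d\<in>UNIV. \<integral>\<^sup>+k. (\<Prod>i\<in>UNIV. ennreal (F d i (k $ i))) \<partial>lborel)"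
    by (rule nn_integral_sum) measurable
  also have "\<dots> = (\<Sum>d\<in>UNIV. \<Prod>i\<in>UNIV. \<integral>\<^sup>+t. ennreal (F d i t) \<partial>lborel)"
    by (intro sum.cong refl nn_integral_lborel_vec_prod) simp
  also have "\<dots> \<le> (\<Sum>d\<in>UNIV. ennreal (D * X d) * ennreal M ^ 2)"
  proof (rule sum_mono)
    fix d :: 3
    have "(\<Prod>i\<in>UNIV. \<integral>\<^sup>+t. ennreal (F d i t) \<partial>lborel) =
        (\<integral>\<^sup>+t. ennreal (F d d t) \<partial>lborel) * (\<Prod>i\<in>UNIV - {d}. \<integral>\<^sup>+t. ennreal (F d i t) \<partial>lborel)"
      by (rule prod.remove) auto
    also have "\<dots> \<le> ennreal (D * X d) * (\<Prod>i\<in>UNIV - {d}. ennreal M)"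
      by (intro mult_mono int_diag prod_mono_ennreal int_off) auto
    also have "card (UNIV - {d}) = 2" by (simp add: card_Diff_singleton)
    then have "(\<Prod>i\<in>UNIV - {d}. ennreal M) = ennreal M ^ 2" by simp
    finally show "(\<Prod>i\<in>UNIV. \<integral>\<^sup>+t. ennreal (F d i t) \<partial>lborel) \<le> ennreal (D * X d) * ennreal M ^ 2" .
  qed
  also have "\<dots> = ennreal (\<Sum>d\<in>UNIV. D * X d * M\<^sup>2)"
    using D X M by (simp add: ennreal_power ennreal_mult[symmetric] sum_ennreal)
  also have "(\<Sum>d\<in>UNIV. D * X d * M\<^sup>2) = D * M\<^sup>2 * (\<Sum>d\<in>UNIV. X d)"
    unfolding sum_distrib_left by (simp only: mult_ac)
  finally show ?thesis by (simp add: D_def M_def X_def)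
qed

section \<open>From the gridding defect to the error\<close>

text \<open>Splitting exp (- i k . r_j) off every grid phase leaves coordinates relative to particle
  j. Together with the phase of particle i it becomes the phase of r_i - r_j, the form in which the
  Debye-Hueckel assumption applies.\<close>

lemma error_integrand_eq:
  "(S_scal \<tau> S H N q r k - S_scal_grid \<tau> S H h P N q r rbar k) * of_real (window_hat S H k) * exp (\<i> * of_real (k \<bullet> r i)) =
    of_real (\<tau> k / ((norm k)\<^sup>2 * \<bar>window_hat S H k\<bar>\<^sup>2) * window_hat S H k) *
    (\<Sum>j<N. of_real (q j) * exp (\<i> * of_real (k \<bullet> (r i - r j))) * grid_defect S H h P r rbar j k)"
proof -
  have defect: "of_real (q j * window_hat S H k) * exp (- \<i> * of_real (k \<bullet> r j)) -
      of_real (q j) * (of_real (cell_volume h) *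
        (\<Sum>n\<in>stencil P. of_real (window S H (rbar j + mesh_shift h n - r j)) * exp (- \<i> * of_real (k \<bullet> (rbar j + mesh_shift h n))))) =
      of_real (q j) * exp (- \<i> * of_real (k \<bullet> r j)) * grid_defect S H h P r rbar j k" for j
  proof -
    have "exp (- \<i> * of_real (k \<bullet> (rbar j + mesh_shift h n))) =
        exp (- \<i> * of_real (k \<bullet> r j)) * exp (- \<i> * of_real (k \<bullet> (rbar j + mesh_shift h n - r j)))" for n
      by (simp add: exp_add[symmetric] inner_diff_right inner_add_right algebra_simps)
    then show ?thesis
      unfolding grid_defect_def by (simp only: right_diff_distrib sum_distrib_left of_real_mult ac_simps)
  qed
  have "exp (- \<i> * of_real (k \<bullet> r j)) * exp (\<i> * of_real (k \<bullet> r i)) = exp (\<i> * of_real (k \<bullet> (r i - r j)))" for j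
    by (simp add: exp_add[symmetric] inner_diff_right algebra_simps)
  then have phase: "of_real (q j) * exp (- \<i> * of_real (k \<bullet> r j)) * G * exp (\<i> * of_real (k \<bullet> r i)) =
     of_real (q j) * exp (\<i> * of_real (k \<bullet> (r i - r j))) * G" for j G
    by (metis mult.assoc mult.commute)
  have "S_scal \<tau> S H N q r k - S_scal_grid \<tau> S H h P N q r rbar k =
      of_real (\<tau> k / ((norm k)\<^sup>2 * \<bar>window_hat S H k\<bar>\<^sup>2)) *
      (\<Sum>j<N. of_real (q j) * exp (- \<i> * of_real (k \<bullet> r j)) * grid_defect S H h P r rbar j k)"
    unfolding S_scal_def S_scal_grid_def right_diff_distrib[symmetric] sum_subtractf[symmetric] defect ..
  then show ?thesis
    unfolding phase[symmetric] sum_distrib_right[symmetric] by (simp add: ac_simps)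
qed

text \<open>The assumption is used with g_j equal to the defect divided by D, so the whole charge
  sum is at most C Q D. The factor k^2 of \<open>tau_mid\<close> cancels against the
  denominator.\<close>

lemma norm_error_integrand_le:
  assumes dh: "debye_hueckel C S H h P N q r rbar" and i: "i < N" and q: "q_max N q = Q"
    and defect: "\<And>j. j < N \<Longrightarrow> norm (grid_defect S H h P r rbar j k) \<le> D" and D: "D > 0" and W: "window_hat S H k > 0"
    and w: "\<And>l. l \<le> m \<Longrightarrow> sog_w b \<sigma> \<omega> l \<ge> 0" and s: "\<And>l. l \<le> m \<Longrightarrow> sog_s b \<sigma> l \<ge> 0"
  shows "norm ((S_scal (tau_mid b \<sigma> \<omega> m) S H N q r k - S_scal_grid (tau_mid b \<sigma> \<omega> m) S H h P N q r rbar k) *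
       of_real (window_hat S H k) * exp (\<i> * of_real (k \<bullet> r i)))
    \<le> (\<Sum>l\<le>m. sqrt pi / 4 * sog_w b \<sigma> \<omega> l * sog_s b \<sigma> l ^ 3 * \<bar>C * Q\<bar> *
          (exp (- ((sog_s b \<sigma> l)\<^sup>2 * (norm k)\<^sup>2 / 4)) * (D / window_hat S H k)))"
proof -
  define Z where "Z = (\<Sum>j<N. of_real (q j) * exp (\<i> * of_real (k \<bullet> (r i - r j))) * grid_defect S H h P r rbar j k)"
  define T where "T = (\<Sum>l\<le>m. sqrt pi / 4 * sog_w b \<sigma> \<omega> l * sog_s b \<sigma> l ^ 3 * exp (- ((sog_s b \<sigma> l)\<^sup>2 * (norm k)\<^sup>2 / 4)))"
  have T: "T \<ge> 0" unfolding T_def using w s by (intro sum_nonneg mult_nonneg_nonneg) auto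
  have "norm (\<Sum>j<N. of_real (q j) * exp (\<i> * of_real (k \<bullet> (r i - r j))) * (grid_defect S H h P r rbar j k / of_real D)) \<le> C * q_max N q"
  proof (rule dh[unfolded debye_hueckel_def, rule_format, OF i])
    show "\<exists>M>0. \<forall>j<N. grid_defect S H h P r rbar j k / of_real D = grid_defect S H h P r rbar j k / of_real M"
      using D by blast
    show "norm (grid_defect S H h P r rbar j k / of_real D) \<le> 1" if "j < N" for j
      using defect[OF that] D by (simp add: norm_divide)
  qed
  moreover have "(\<Sum>j<N. of_real (q j) * exp (\<i> * of_real (k \<bullet> (r i - r j))) * (grid_defect S H h P r rbar j k / of_real D)) = Z / of_real D"
    by (simp add: Z_def sum_divide_distrib)
  ultimately have "norm Z / D \<le> C * Q" using q D by (simp add: norm_divide)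
  then have Z: "norm Z \<le> \<bar>C * Q\<bar> * D" using D by (simp add: pos_divide_le_eq) (smt (verit) mult_right_mono)
  have tau: "tau_mid b \<sigma> \<omega> m k = (norm k)\<^sup>2 * T"
    unfolding tau_mid_def T_def by (simp add: sum_distrib_left mult_ac)
  \<comment> \<open>At k = 0 division by zero yields 0, which lies below the value T / W of the
    continuous extension.\<close>
  have "tau_mid b \<sigma> \<omega> m k / ((norm k)\<^sup>2 * \<bar>window_hat S H k\<bar>\<^sup>2) * window_hat S H k = (if k = 0 then 0 else T / window_hat S H k)"
    using W by (simp add: tau power2_eq_square)
  moreover have "\<bar>if k = 0 then 0 else T / window_hat S H k\<bar> \<le> T / window_hat S H k"
  proof -
    have "T / window_hat S H k \<ge> 0" using T W by simp
    then show ?thesis by (metis (full_types) abs_of_nonneg abs_zero order_refl)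
  qed
  ultimately have "norm (of_real (tau_mid b \<sigma> \<omega> m k / ((norm k)\<^sup>2 * \<bar>window_hat S H k\<bar>\<^sup>2) * window_hat S H k) * Z)
      \<le> T / window_hat S H k * (\<bar>C * Q\<bar> * D)"
    unfolding norm_mult[of _ Z] norm_of_real using Z T W by (simp only:) (intro mult_mono; simp)
  also have "\<dots> = (\<Sum>l\<le>m. sqrt pi / 4 * sog_w b \<sigma> \<omega> l * sog_s b \<sigma> l ^ 3 * \<bar>C * Q\<bar> *
          (exp (- ((sog_s b \<sigma> l)\<^sup>2 * (norm k)\<^sup>2 / 4)) * (D / window_hat S H k)))"
    unfolding T_def by (simp add: sum_distrib_left sum_distrib_right sum_divide_distrib mult_ac)
  finally show ?thesis
    unfolding error_integrand_eq Z_def .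
qed

lemma norm_error_scal_le:
  fixes b \<sigma> \<omega> C Q \<mu>0 c :: real and m :: nat and E :: "nat \<Rightarrow> 3 \<Rightarrow> real"
  assumes pos: "b > 1" "\<sigma> > 0" "\<omega> > 0" "\<mu>0 > 0" "c > 0"
    and S: "S \<ge> c" and h: "\<And>d. h $ d > 0" and p: "\<And>d. p d \<ge> 1" and H: "\<And>d. H $ d = real (p d) * h $ d"
    and P: "\<And>d. real (P $ d) = 2 * real (p d) + 1"
    and near: "\<And>j. j < N \<Longrightarrow> nearest_in (uniform_grid x0 h) (r j) (rbar j)"
    and dh: "debye_hueckel C S H h P N q r rbar" and i: "i < N" and q: "q_max N q = Q"
    and \<mu>: "\<And>l d. l \<le> m \<Longrightarrow> mu b \<sigma> S H l d \<ge> \<mu>0"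
    and E: "\<And>l d. E l d = pi\<^sup>2 * mu b \<sigma> S H l d * (real (P $ d) - 1)\<^sup>2 / (4 * (sog_s b \<sigma> l)\<^sup>2 * S)"
      "\<And>l d. l \<le> m \<Longrightarrow> E l d \<ge> c"
  shows "norm (error_scal bulk_avg (tau_mid b \<sigma> \<omega> m) S H h P N q r rbar i) \<le>
    4 * pi / (2 * pi) ^ 3 * (\<Sum>l\<le>m. sqrt pi / 4 * sog_w b \<sigma> \<omega> l * sog_s b \<sigma> l ^ 3 * \<bar>C * Q\<bar> *
      (defect_const c \<mu>0 * (2 * sqrt pi / sqrt \<mu>0 + 3 * defect_const c \<mu>0)\<^sup>2 * (\<Sum>d\<in>UNIV. exp (- E l d) + erfc (sqrt S))))"
proof -
  have S0: "S > 0" using S pos by simp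
  have Hp: "H $ d > 0" for d using H p[of d] h[of d] by simp
  define f where "f k = (S_scal (tau_mid b \<sigma> \<omega> m) S H N q r k - S_scal_grid (tau_mid b \<sigma> \<omega> m) S H h P N q r rbar k) *
       of_real (window_hat S H k) * exp (\<i> * of_real (k \<bullet> r i))" for k
  define A where "A l = sqrt pi / 4 * sog_w b \<sigma> \<omega> l * sog_s b \<sigma> l ^ 3 * \<bar>C * Q\<bar>" for l
  define I where "I l = defect_const c \<mu>0 * (2 * sqrt pi / sqrt \<mu>0 + 3 * defect_const c \<mu>0)\<^sup>2 * (\<Sum>d\<in>UNIV. exp (- E l d) + erfc (sqrt S))" for l
  have s: "sog_s b \<sigma> l > 0" for l using pos by (simp add: sog_s_def)
  have w: "sog_w b \<sigma> \<omega> l \<ge> 0" for l using pos by (simp add: sog_w_def)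
  have A: "A l \<ge> 0" for l unfolding A_def using s[of l] w[of l] by simp
  have I: "I l \<ge> 0" for l
    unfolding I_def using defect_const_nonneg pos by (intro mult_nonneg_nonneg sum_nonneg add_nonneg_nonneg erfc_nonneg) auto
  define B where "B = (\<Sum>l\<le>m. A l * I l)"
  have B: "B \<ge> 0" unfolding B_def using A I by (intro sum_nonneg mult_nonneg_nonneg) auto
  define g where "g l k = exp (- ((sog_s b \<sigma> l)\<^sup>2 * (norm k)\<^sup>2 / 4)) * (defect_bound S H h p k / window_hat S H k)" for l k
  have pos_D: "defect_bound S H h p k > 0" and pos_W: "window_hat S H k > 0" for k
    using S0 h p Hp by (auto intro!: defect_bound_pos window_hat_pos)
  have g: "g l k \<ge> 0" for l k
    using pos_D[of k] pos_W[of k] by (simp add: g_def)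
  have [measurable]: "window1_defect S (h $ d) (p d) \<in> borel_measurable borel" for d
    using S0 p by simp
  have [measurable]: "g l \<in> borel_measurable borel" for l
  proof -
    have "(\<lambda>k. if i = d then window1_defect S (h $ i) (p i) (k $ i)
        else window1_hat S (H $ i) (k $ i) + window1_defect S (h $ i) (p i) (k $ i)) \<in> borel_measurable borel" for i d :: 3
      by (cases "i = d") simp_all
    then show ?thesis
      unfolding g_def[abs_def] defect_bound_def window_hat_def by measurable
  qed
  have "norm (LINT k|lborel. f k) \<le> B"
  \<comment> \<open>A function that is not integrable has Bochner integral 0, so in that case the
    bound holds because B >= 0.\<close>
  proof (cases "integrable lborel f")
    case True
    then have "ennreal (norm (LINT k|lborel. f k)) \<le> (\<integral>\<^sup>+k. ennreal (norm (f k)) \<partial>lborel)"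
      by (rule integral_norm_bound_ennreal)
    also have "\<dots> \<le> (\<integral>\<^sup>+k. (\<Sum>l\<le>m. ennreal (A l) * ennreal (g l k)) \<partial>lborel)"
    proof (rule nn_integral_mono)
      fix k
      have "norm (f k) \<le> (\<Sum>l\<le>m. A l * g l k)"
        unfolding f_def A_def g_def
        by (rule norm_error_integrand_le[OF dh i q _ pos_D pos_W])
          (auto intro!: norm_grid_defect_le[OF S0 h p H P near] w less_imp_le[OF s])
      then have "ennreal (norm (f k)) \<le> ennreal (\<Sum>l\<le>m. A l * g l k)" by (rule ennreal_leI)
      also have "\<dots> = (\<Sum>l\<le>m. ennreal (A l) * ennreal (g l k))"
        using A g by (simp add: sum_ennreal[symmetric] ennreal_mult)
      finally show "ennreal (norm (f k)) \<le> (\<Sum>l\<le>m. ennreal (A l) * ennreal (g l k))" .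
    qed
    also have "\<dots> = (\<Sum>l\<le>m. ennreal (A l) * (\<integral>\<^sup>+k. ennreal (g l k) \<partial>lborel))"
      by (subst nn_integral_sum) (simp_all add: nn_integral_cmult)
    also have "\<dots> \<le> (\<Sum>l\<le>m. ennreal (A l) * ennreal (I l))"
    proof (intro sum_mono mult_left_mono)
      fix l assume "l \<in> {..m}"
      then have l: "l \<le> m" by simp
      show "(\<integral>\<^sup>+k. ennreal (g l k) \<partial>lborel) \<le> ennreal (I l)"
        unfolding g_def I_def
        by (rule nn_integral_defect_bound[where \<mu> = "mu b \<sigma> S H l"])
          (use pos S h p H s \<mu>[OF l] E(2)[OF l] in \<open>simp_all add: mu_def E(1) P\<close>)
    qed simp
    also have "\<dots> = ennreal B"
      unfolding B_def using A I by (simp add: sum_ennreal[symmetric] ennreal_mult)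
    finally show ?thesis using B by (simp add: ennreal_le_iff)
  qed (use B in \<open>simp add: not_integrable_integral_eq\<close>)
  then have "4 * pi / (2 * pi) ^ 3 * norm (LINT k|lborel. f k) \<le> 4 * pi / (2 * pi) ^ 3 * B"
    by (rule mult_left_mono) simp
  then show ?thesis
    unfolding error_scal_def bulk_avg_def f_def[symmetric] B_def A_def I_def
    by (simp add: norm_mult norm_divide norm_power)
qed

text \<open>The implied constant K is chosen before charges, positions, grid and window; it may
  depend only on the SOG parameters, C, Q, \<mu>0 and c. The \<mu>0 and c hypotheses express the
  regime of the O-estimate.\<close>

theorem theorem4p3:
  fixes b \<sigma> \<omega> C Q \<mu>0 c :: real and m :: nat
  assumes "b > 1" and "\<sigma> > 0" and "\<omega> > 0" and "\<mu>0 > 0" and "c > 0"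
  shows "\<exists>K. \<forall>(N :: nat) (q :: nat \<Rightarrow> real) (r :: nat \<Rightarrow> real ^ 3) (L :: real ^ 3) (\<eta> :: real)
      (h :: real ^ 3) (x0 :: real ^ 3) (rbar :: nat \<Rightarrow> real ^ 3)
      (S :: real) (H :: real ^ 3) (P :: nat ^ 3).
    charge_system N q r L \<and> q_max N q = Q \<and>
    \<eta> > 0 \<and> sog_s b \<sigma> m \<le> \<eta> * L $ 3 \<and> \<eta> * L $ 3 < sog_s b \<sigma> (m + 1) \<and>
    S > 0 \<and> (\<forall>d. h $ d > 0 \<and> H $ d > 0 \<and> odd (P $ d) \<and> real (P $ d) = 2 * H $ d / h $ d + 1) \<and>
    (\<forall>j<N. nearest_in (uniform_grid x0 h) (r j) (rbar j)) \<and>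
    debye_hueckel C S H h P N q r rbar \<and>
    (\<forall>d. \<forall>l\<le>m. (H $ d)\<^sup>2 / S < (sog_s b \<sigma> l)\<^sup>2 \<and> (sog_s b \<sigma> l)\<^sup>2 \<le> (sog_s b \<sigma> m)\<^sup>2) \<and>
    (\<forall>d. \<forall>l\<le>m. mu b \<sigma> S H l d \<ge> \<mu>0) \<and>
    S \<ge> c \<and>
    (\<forall>d. \<forall>l\<le>m. pi\<^sup>2 * mu b \<sigma> S H l d * (real (P $ d) - 1)\<^sup>2 / (4 * (sog_s b \<sigma> l)\<^sup>2 * S) \<ge> c)
    \<longrightarrow>
    (MAX i\<in>{..<N}. norm (error_scal bulk_avg (tau_mid b \<sigma> \<omega> m) S H h P N q r rbar i)) \<le>
      K * ((MAX d\<in>UNIV. \<Sum>l\<le>m. sog_w b \<sigma> \<omega> l *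
              exp (- (pi\<^sup>2 * mu b \<sigma> S H l d * (real (P $ d) - 1)\<^sup>2 / (4 * (sog_s b \<sigma> l)\<^sup>2 * S))))
           + erfc (sqrt S))"
proof -
  define w where "w = sog_w b \<sigma> \<omega>"
  define s where "s = sog_s b \<sigma>"
  define D where "D = defect_const c \<mu>0 * (2 * sqrt pi / sqrt \<mu>0 + 3 * defect_const c \<mu>0)\<^sup>2"
  define W where "W = (\<Sum>l\<le>m. w l)"
  define K0 where "K0 = 4 * pi / (2 * pi) ^ 3 * (sqrt pi / 4 * \<bar>C * Q\<bar> * D)"
  \<comment> \<open>The factor \<open>s m ^ 3\<close> bounds all s_l^3, the 3 counts the
    coordinates, and 1 + W absorbs the weights w_l, which multiply erfc in the derivation but not in
    the claim.\<close>
  define K where "K = K0 * (s m ^ 3 * (3 * (1 + W)))"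
  have s: "s l > 0" for l using assms by (simp add: s_def sog_s_def)
  have w: "w l \<ge> 0" for l using assms by (simp add: w_def sog_w_def)
  have s_le: "s l \<le> s m" if "l \<le> m" for l
    using assms that by (simp add: s_def sog_s_def power_increasing)
  have D: "D \<ge> 0" using assms by (simp add: D_def defect_const_nonneg)
  have W: "W \<ge> 0" unfolding W_def using w by (intro sum_nonneg)
  have K0: "K0 \<ge> 0" using D by (simp add: K0_def)
  show ?thesis
  proof (intro exI[of _ K] allI impI, elim conjE)
    fix N q r L \<eta> h x0 rbar S and H :: "real ^ 3" and P :: "nat ^ 3"
    assume "charge_system N q r L" and q: "q_max N q = Q" and S: "S > 0" "S \<ge> c"
      and grid: "\<forall>d. h $ d > 0 \<and> H $ d > 0 \<and> odd (P $ d) \<and> real (P $ d) = 2 * H $ d / h $ d + 1"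
      and near: "\<forall>j<N. nearest_in (uniform_grid x0 h) (r j) (rbar j)"
      and dh: "debye_hueckel C S H h P N q r rbar"
      and \<mu>: "\<forall>d. \<forall>l\<le>m. mu b \<sigma> S H l d \<ge> \<mu>0"
      and E: "\<forall>d. \<forall>l\<le>m. pi\<^sup>2 * mu b \<sigma> S H l d * (real (P $ d) - 1)\<^sup>2 / (4 * (sog_s b \<sigma> l)\<^sup>2 * S) \<ge> c"
    define e where "e l d = pi\<^sup>2 * mu b \<sigma> S H l d * (real (P $ d) - 1)\<^sup>2 / (4 * (sog_s b \<sigma> l)\<^sup>2 * S)" for l d
    define X where "X = (MAX d\<in>UNIV. \<Sum>l\<le>m. w l * exp (- e l d))"
    define t where "t = erfc (sqrt S)"
    have t: "t \<ge> 0" by (simp add: t_def erfc_nonneg)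
    have X: "(\<Sum>l\<le>m. w l * exp (- e l d)) \<le> X" for d
      unfolding X_def by (intro Max_ge) auto
    have X0: "X \<ge> 0" by (rule order_trans[OF sum_nonneg X[of 1]]) (simp add: w)
    have N: "N \<ge> 1" using \<open>charge_system N q r L\<close> by (simp add: charge_system_def)
    \<comment> \<open>For odd P this is (P - 1) / 2, the half-width of the window in mesh units; H >
      0 forces it to be at least 1.\<close>
    define p where "p d = P $ d div 2" for d
    have P: "real (P $ d) = 2 * real (p d) + 1" for d
    proof -
      have "P $ d = 2 * p d + 1" using grid unfolding p_def by (metis odd_two_times_div_two_succ)
      then show ?thesis by simp
    qed
    have H: "H $ d = real (p d) * h $ d" for d
    proof -
      have "h $ d > 0" "2 * real (p d) = 2 * H $ d / h $ d" using grid P[of d] by simp_all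
      then show ?thesis by (simp add: field_simps)
    qed
    have p: "p d \<ge> 1" for d
      using grid H[of d] by (metis less_one linorder_not_le mult_zero_left of_nat_0 order_less_irrefl)
    have bound: "norm (error_scal bulk_avg (tau_mid b \<sigma> \<omega> m) S H h P N q r rbar i) \<le> K * (X + t)" if i: "i < N" for i
    proof -
      have "norm (error_scal bulk_avg (tau_mid b \<sigma> \<omega> m) S H h P N q r rbar i) \<le>
        4 * pi / (2 * pi) ^ 3 * (\<Sum>l\<le>m. sqrt pi / 4 * w l * s l ^ 3 * \<bar>C * Q\<bar> * (D * (\<Sum>d\<in>UNIV. exp (- e l d) + t)))"
        unfolding w_def s_def D_def t_def
        by (rule norm_error_scal_le[where p = p]) (use assms S grid p H P near dh i q \<mu> E in \<open>auto simp: e_def\<close>)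
      also have "\<dots> = K0 * (\<Sum>l\<le>m. w l * s l ^ 3 * (\<Sum>d\<in>UNIV. exp (- e l d) + t))"
        unfolding K0_def by (simp only: sum_distrib_left mult_ac)
      also have "\<dots> \<le> K0 * (\<Sum>l\<le>m. w l * s m ^ 3 * (\<Sum>d\<in>UNIV. exp (- e l d) + t))"
        using s s_le w t K0
        by (intro mult_left_mono sum_mono mult_right_mono power_mono sum_nonneg add_nonneg_nonneg) (auto intro: less_imp_le)
      also have "(\<Sum>l\<le>m. w l * s m ^ 3 * (\<Sum>d\<in>UNIV. exp (- e l d) + t)) =
          s m ^ 3 * (\<Sum>l\<le>m. \<Sum>d\<in>UNIV. w l * exp (- e l d) + w l * t)"
        by (simp only: sum_distrib_left distrib_left mult_ac)
      \<comment> \<open>With the sum over the coordinates outside, each inner sum over l is one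
        candidate of the maximum X.\<close>
      also have "(\<Sum>l\<le>m. \<Sum>d\<in>UNIV. w l * exp (- e l d) + w l * t) = (\<Sum>d\<in>UNIV. (\<Sum>l\<le>m. w l * exp (- e l d)) + W * t)"
        by (subst sum.swap) (simp add: sum.distrib W_def sum_distrib_right)
      also have "\<dots> \<le> (\<Sum>d\<in>(UNIV :: 3 set). X + W * t)"
        by (intro sum_mono add_right_mono X)
      also have "\<dots> = 3 * (X + W * t)" by simp
      also have "\<dots> \<le> 3 * (1 + W) * (X + t)"
        using X0 W t by (simp add: algebra_simps)
      finally show ?thesis
        using K0 s[of m] unfolding K_def by (simp add: mult.assoc mult_left_mono)
    qed
    show "(MAX i\<in>{..<N}. norm (error_scal bulk_avg (tau_mid b \<sigma> \<omega> m) S H h P N q r rbar i)) \<le>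
      K * ((MAX d\<in>UNIV. \<Sum>l\<le>m. sog_w b \<sigma> \<omega> l *
              exp (- (pi\<^sup>2 * mu b \<sigma> S H l d * (real (P $ d) - 1)\<^sup>2 / (4 * (sog_s b \<sigma> l)\<^sup>2 * S))))
           + erfc (sqrt S))"
      unfolding e_def[symmetric] w_def[symmetric] X_def[symmetric] t_def[symmetric]
      using N bound by (intro Max.boundedI) (auto simp: lessThan_empty_iff)
  qed
qed

end
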